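(* Let $X$ be a quandle and $(D_X,\rho_{+\leftrightarrow -})$ its symmetric double. Let $(D,o)$ be a diagram of an oriented link and take $[C]_{\rm ori}\in{\rm Col}_{(D_X,\rho_{+\leftrightarrow -})}(D)/\!\sim_{\rm ori}$ such that $o$ is the orientation induced by the canonical form of $(D,C)$. Then there exists a one-to-one correspondence between the sets ${\rm Col}_X(D,o)$ and $[C]_{\rm ori}$, and thus \[\#{\rm Col}_X(D,o)=\#[C]_{\rm ori}.\]
   Context: Quandles. A quandle $(X,* )$ is a set $X$ with a binary operation $*$ such that (Q1) $x*x=x$; (Q2) for all $x,y\in X$ there is a unique $z\in X$ with $z*y=x$, denoted $z=x*y^{-1}$; (Q3) $(x*y)*z=(x*z)*(y*z)$. Write $x*y^{+1}=x*y$. A good involution of $X$ is an involution $\rho:X\to X$ with $\rho(x*y)=\rho(x)*y$ and $x*\rho(y)=x*y^{-1}$; the pair $(X,\rho)$ is then a symmetric quandle. The symmetric double of $(X,* )$ is the symmetric quandle $(D_X,\rho_{+\leftrightarrow -})$ with $D_X=X^{+1}\sqcup X^{-1}$, where $X^{\varepsilon}=\{x^{\varepsilon}\mid x\in X\}$ are two copies of $X$, operation $x^{\varepsilon}\star y^{\delta}=(x*y^{\delta})^{\varepsilon}$ and $\rho_{+\leftrightarrow -}(x^{\varepsilon})=x^{-\varepsilon}$. Diagrams. A link is a disjoint union of circles embedded in $\mathbb R^3$; a diagram $D$ is its image under a generic projection to $\mathbb R^2$ with over/under information at crossings, shown by removing neighborhoods of the lower crossing points. Arcs of $D$ are the connected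 components of the resulting figure (so an arc runs over crossings and ends at undercrossings); semi-arcs are the connected components left after removing neighborhoods of all crossings. If $D$ has orientation $o$, each arc gets the normal orientation $n$ such that the pair $(o,n)$ is the right-handed orientation of $\mathbb R^2$. $X$-colorings. An $X$-coloring of an oriented diagram $(D,o)$ assigns an element of $X$ to each arc so that at each crossing, if the under-arcs $\alpha_1,\alpha_2$ have labels $x_1,x_2$, the over-arc has label $x_3$, and the normal orientation of the over-arc points from $\alpha_1$ to $\alpha_2$, then $x_1*x_3=x_2$. ${\rm Col}_X(D,o)$ is the set of $X$-colorings. $(X,\rho)$-colorings. For a symmetric quandle $(X,\rho)$, an $(X,\rho)$-coloring of an unoriented diagram $D$ is an equivalence class of assignments of a normal orientation and an element of $X$ to each semi-arc such that at each crossing: (i) if the two over-semi-arcs have labels $x_1,x_2$, then $x_1=x_2$ if their normal orientations are coherent and $x_1=\rho(x_2)$ otherwise; (ii) if the under-semi-arcs $\alpha_1,\alpha_2$ have labels $x_1,x_2$, one of the over-semi-arcs has label $x_3$ and its normal orientation points from $\alpha_1$ to $\alpha_2$, then $x_1*x_3=x_2$ if the normal orientations of $\alpha_1,\alpha_2$ are coherent, and $x_1*x_3=\rho(x_2)$ otherwise. The equivalence relation is generated by basic inversions: reversing the normal orientation of a semi-arc and replacing its label $x$ by $\rho(x)$. ${\rm Col}_{(X,\rho)}(D)$ is the set of $(X,\rho)$-colorings. Canonical form. Every $(D_X,\rho_{+\leftrightarrow -})$-coloring $C$ of $D$ is represented by a unique assignment in which all labels lie in $X^{+1}$, the canonical form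 of $C$ (or of $(D,C)$). Its normal orientations are coherent along each component of the link; giving each semi-arc the orientation $o_\alpha$ such that $(o_\alpha,n_\alpha)$ is right-handed, with $n_\alpha$ the normal orientation in the canonical form, yields an orientation of $D$, called the orientation induced by the canonical form of $(D,C)$. Two colorings $C,C'$ satisfy $C\sim_{\rm ori}C'$ if their canonical forms induce the same orientation of $D$; $[C]_{\rm ori}$ is the equivalence class of $C$, a subset of ${\rm Col}_{(D_X,\rho_{+\leftrightarrow -})}(D)$. $\#$ denotes cardinality. *)

theory Defs
  imports "HOL-Analysis.Analysis"
begin

section \<open>Quandles and symmetric quandles\<close>

text \<open>The element written \<open>x * y\<close> to the exponent -1 (on \<open>y\<close>) in the literature.\<close>

definition qdiv :: "'a set \<Rightarrow> ('a \<Rightarrow> 'a \<Rightarrow> 'a) \<Rightarrow> 'a \<Rightarrow> 'a \<Rightarrow> 'a" where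
  "qdiv X f x y = (THE z. z \<in> X \<and> f z y = x)"

locale quandle =
  fixes X :: "'a set" and star :: "'a \<Rightarrow> 'a \<Rightarrow> 'a"  (infixl "\<triangleright>" 70)
  assumes closed: "\<lbrakk>x \<in> X; y \<in> X\<rbrakk> \<Longrightarrow> x \<triangleright> y \<in> X"
    and Q1: "x \<in> X \<Longrightarrow> x \<triangleright> x = x"
    and Q2: "\<lbrakk>x \<in> X; y \<in> X\<rbrakk> \<Longrightarrow> \<exists>!z. z \<in> X \<and> z \<triangleright> y = x"
    and Q3: "\<lbrakk>x \<in> X; y \<in> X; z \<in> X\<rbrakk> \<Longrightarrow> (x \<triangleright> y) \<triangleright> z = (x \<triangleright> z) \<triangleright> (y \<triangleright> z)"

locale symmetric_quandle = quandle X star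
  for X :: "'a set" and star :: "'a \<Rightarrow> 'a \<Rightarrow> 'a"  (infixl "\<triangleright>" 70) +
  fixes \<rho> :: "'a \<Rightarrow> 'a"
  assumes rho_closed: "x \<in> X \<Longrightarrow> \<rho> x \<in> X"
    and rho_involution: "x \<in> X \<Longrightarrow> \<rho> (\<rho> x) = x"
    and rho_left: "\<lbrakk>x \<in> X; y \<in> X\<rbrakk> \<Longrightarrow> \<rho> (x \<triangleright> y) = \<rho> x \<triangleright> y"
    and rho_right: "\<lbrakk>x \<in> X; y \<in> X\<rbrakk> \<Longrightarrow> x \<triangleright> \<rho> y = qdiv X (\<triangleright>) x y"

datatype sign = Pos | Neg

fun sign_flip :: "sign \<Rightarrow> sign" where
  "sign_flip Pos = Neg"
| "sign_flip Neg = Pos"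

fun qpow :: "'a set \<Rightarrow> ('a \<Rightarrow> 'a \<Rightarrow> 'a) \<Rightarrow> 'a \<Rightarrow> 'a \<Rightarrow> sign \<Rightarrow> 'a" where
  "qpow X f x y Pos = f x y"
| "qpow X f x y Neg = qdiv X f x y"

text \<open>The pair \<open>(x, e)\<close> is the element \<open>x\<close> of the copy of \<open>X\<close> with sign \<open>e\<close>.\<close>

definition double_carrier :: "'a set \<Rightarrow> ('a \<times> sign) set" where
  "double_carrier X = X \<times> UNIV"

definition double_op :: "'a set \<Rightarrow> ('a \<Rightarrow> 'a \<Rightarrow> 'a) \<Rightarrow> 'a \<times> sign \<Rightarrow> 'a \<times> sign \<Rightarrow> 'a \<times> sign" where
  "double_op X f u v = (qpow X f (fst u) (fst v) (snd v), snd u)"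

definition double_inv :: "'a \<times> sign \<Rightarrow> 'a \<times> sign" where
  "double_inv u = (fst u, sign_flip (snd u))"

context quandle
begin

lemma qdiv_spec:
  assumes "x \<in> X" "y \<in> X"
  shows "qdiv X star x y \<in> X \<and> qdiv X star x y \<triangleright> y = x"
  unfolding qdiv_def by (rule theI') (rule Q2[OF assms])

lemmas qdiv_in = qdiv_spec[THEN conjunct1]
  and qdiv_star = qdiv_spec[THEN conjunct2]

lemma qdiv_eqI:
  assumes "z \<in> X" "y \<in> X" "z \<triangleright> y = x"
  shows "qdiv X star x y = z"
proof -
  have "x \<in> X" using closed[OF assms(1,2)] assms(3) by simp
  then show ?thesis
    unfolding qdiv_def using assms by (intro the1_equality Q2) auto
qed

lemma star_qdiv: "\<lbrakk>x \<in> X; y \<in> X\<rbrakk> \<Longrightarrow> qdiv X star (x \<triangleright> y) y = x"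
  by (rule qdiv_eqI) auto

lemma qpow_in: "\<lbrakk>x \<in> X; y \<in> X\<rbrakk> \<Longrightarrow> qpow X star x y e \<in> X"
  by (cases e) (auto simp: closed qdiv_in)

lemma qpow_flip: "\<lbrakk>x \<in> X; y \<in> X\<rbrakk> \<Longrightarrow> qpow X star (qpow X star x y e) y (sign_flip e) = x"
  by (cases e) (auto simp: star_qdiv qdiv_star)

lemma qdiv_star_distrib:
  assumes "x \<in> X" "y \<in> X" "z \<in> X"
  shows "qdiv X star x y \<triangleright> z = qdiv X star (x \<triangleright> z) (y \<triangleright> z)"
  using assms Q3[of "qdiv X star x y" y z]
  by (intro qdiv_eqI[symmetric]) (simp_all add: closed qdiv_in qdiv_star)

lemma qpow_star_distrib:
  assumes "x \<in> X" "y \<in> X" "z \<in> X"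
  shows "qpow X star x y e \<triangleright> z = qpow X star (x \<triangleright> z) (y \<triangleright> z) e"
  using assms by (cases e) (auto simp: Q3 qdiv_star_distrib)

lemma qpow_distrib:
  assumes "x \<in> X" "y \<in> X" "z \<in> X"
  shows "qpow X star (qpow X star x y e) z d
       = qpow X star (qpow X star x z d) (qpow X star y z d) e"
proof (cases d)
  case Pos
  then show ?thesis using assms by (simp add: qpow_star_distrib)
next
  case Neg
  have "qpow X star (qdiv X star x z) (qdiv X star y z) e \<triangleright> z = qpow X star x y e"
    using assms by (simp add: qpow_star_distrib qdiv_in qdiv_star)
  from qdiv_eqI[OF _ _ this] show ?thesis using assms Neg by (simp add: qpow_in qdiv_in)
qed

lemma symmetric_double:
  "symmetric_quandle (double_carrier X) (double_op X star) double_inv"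
proof -
  have ff: "sign_flip (sign_flip e) = e" for e by (cases e) auto
  have un: "a = qpow X star x y (sign_flip e)"
    if "a \<in> X" "x \<in> X" "y \<in> X" "qpow X star a y e = x" for a x y e
    using that qpow_flip[of a y e] by simp
  have q: "quandle (double_carrier X) (double_op X star)"
  proof
    fix u v w :: "'a \<times> sign"
    show "u \<in> double_carrier X \<Longrightarrow> v \<in> double_carrier X \<Longrightarrow> double_op X star u v \<in> double_carrier X"
      by (auto simp: double_carrier_def double_op_def qpow_in)
    show "u \<in> double_carrier X \<Longrightarrow> double_op X star u u = u"
      by (cases "snd u"; cases u) (auto simp: double_carrier_def double_op_def Q1 intro!: qdiv_eqI)
    show "\<exists>!z. z \<in> double_carrier X \<and> double_op X star z v = u"
      if "u \<in> double_carrier X" "v \<in> double_carrier X"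
    proof
      show "(qpow X star (fst u) (fst v) (sign_flip (snd v)), snd u) \<in> double_carrier X \<and>
        double_op X star (qpow X star (fst u) (fst v) (sign_flip (snd v)), snd u) v = u"
        using that qpow_flip[of "fst u" "fst v" "sign_flip (snd v)"]
        by (auto simp: double_carrier_def double_op_def qpow_in ff)
    next
      fix z assume "z \<in> double_carrier X \<and> double_op X star z v = u"
      then show "z = (qpow X star (fst u) (fst v) (sign_flip (snd v)), snd u)"
        using that un[of "fst z" "fst u" "fst v" "snd v"]
        by (cases z) (auto simp: double_carrier_def double_op_def)
    qed
    show "double_op X star (double_op X star u v) w
        = double_op X star (double_op X star u w) (double_op X star v w)"
      if "u \<in> double_carrier X" "v \<in> double_carrier X" "w \<in> double_carrier X"
      using that by (auto simp: double_carrier_def double_op_def qpow_distrib)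
  qed
  interpret D: quandle "double_carrier X" "double_op X star" by (rule q)
  show ?thesis
  proof
    fix u v :: "'a \<times> sign"
    show "u \<in> double_carrier X \<Longrightarrow> double_inv u \<in> double_carrier X"
      by (auto simp: double_carrier_def double_inv_def)
    show "double_inv (double_inv u) = u" by (simp add: double_inv_def ff)
    show "double_inv (double_op X star u v) = double_op X star (double_inv u) v"
      by (simp add: double_inv_def double_op_def)
    show "double_op X star u (double_inv v) = qdiv (double_carrier X) (double_op X star) u v"
      if "u \<in> double_carrier X" "v \<in> double_carrier X"
      using that qpow_flip[of "fst u" "fst v" "sign_flip (snd v)"]
      by (intro D.qdiv_eqI[symmetric])
        (auto simp: double_carrier_def double_op_def double_inv_def qpow_in ff)
  qed
qed

end


section \<open>Link diagrams\<close>

text \<open>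
  A link is given by regular C1 parametrisations of its finitely many components, each of period 1.
  The projection is along the third axis and heights are third coordinates, so a diagram is
  a link whose projection is generic: an immersion whose only multiple points are finitely
  many transverse double points.
\<close>

type_synonym space = "real ^ 3"
type_synonym plane = "real ^ 2"
type_synonym diagram = "(real \<Rightarrow> space) list"

definition plane_proj :: "space \<Rightarrow> plane" where
  "plane_proj x = vector [x $ 1, x $ 2]"

definition proj_tangent :: "(real \<Rightarrow> space) \<Rightarrow> real \<Rightarrow> plane" where
  "proj_tangent \<gamma> t = vector_derivative (plane_proj \<circ> \<gamma>) (at t)"

definition det2 :: "plane \<Rightarrow> plane \<Rightarrow> real" where
  "det2 u v = det (vector [u, v] :: real ^ 2 ^ 2)"

definition link_points :: "diagram \<Rightarrow> space set" where
  "link_points D = (\<Union>\<gamma>\<in>set D. range \<gamma>)"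

definition link :: "diagram \<Rightarrow> bool" where
  "link D \<longleftrightarrow>
     (\<forall>\<gamma>\<in>set D. \<gamma> C1_differentiable_on UNIV \<and>
        (\<forall>t. vector_derivative \<gamma> (at t) \<noteq> 0) \<and> (\<forall>t. \<gamma> (t + 1) = \<gamma> t)) \<and>
     (\<forall>i<length D. \<forall>j<length D. \<forall>s t. (D ! i) s = (D ! j) t \<longrightarrow> i = j \<and> s - t \<in> \<int>)"

definition crossings :: "diagram \<Rightarrow> (space \<times> space) set" where
  "crossings D = {(p, q). p \<in> link_points D \<and> q \<in> link_points D \<and>
     plane_proj p = plane_proj q \<and> q $ 3 < p $ 3}"

definition generic_projection :: "diagram \<Rightarrow> bool" where
  "generic_projection D \<longleftrightarrow>
     (\<forall>\<gamma>\<in>set D. \<forall>t. proj_tangent \<gamma> t \<noteq> 0) \<and>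
     (\<forall>y. finite {x \<in> link_points D. plane_proj x = y} \<and>
          card {x \<in> link_points D. plane_proj x = y} \<le> 2) \<and>
     finite (crossings D) \<and>
     (\<forall>\<gamma>\<in>set D. \<forall>\<delta>\<in>set D. \<forall>s t. (\<gamma> s, \<delta> t) \<in> crossings D \<longrightarrow>
        det2 (proj_tangent \<gamma> s) (proj_tangent \<delta> t) \<noteq> 0)"

definition link_diagram :: "diagram \<Rightarrow> bool" where
  "link_diagram D \<longleftrightarrow> link D \<and> generic_projection D"

text \<open>
  Arcs and semi-arcs are represented by their lifts to the link. Removing the lower crossing
  points (respectively, both points over each double point) from the link has the same effect
  on connected components as removing neighbourhoods of them from the planar figure.
\<close>

definition arcs :: "diagram \<Rightarrow> space set set" where
  "arcs D = components (link_points D - snd ` crossings D)"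

definition semi_arcs :: "diagram \<Rightarrow> space set set" where
  "semi_arcs D = components (link_points D - (fst ` crossings D \<union> snd ` crossings D))"

text \<open>
  Orientations and normal orientations are continuous planar unit vector fields, tangent
  (respectively, orthogonal) to the projection; they are indexed by points of the link since
  the two strands at a crossing have the same projection.
\<close>

definition orientations :: "diagram \<Rightarrow> (space \<Rightarrow> plane) set" where
  "orientations D = {\<omega> \<in> link_points D \<rightarrow>\<^sub>E sphere 0 1. continuous_on (link_points D) \<omega> \<and>
     (\<forall>\<gamma>\<in>set D. \<forall>t. \<exists>r. \<omega> (\<gamma> t) = r *\<^sub>R proj_tangent \<gamma> t)}"

definition normal_orientations :: "diagram \<Rightarrow> space set \<Rightarrow> (space \<Rightarrow> plane) set" where
  "normal_orientations D \<alpha> = {\<nu> \<in> \<alpha> \<rightarrow>\<^sub>E sphere 0 1. continuous_on \<alpha> \<nu> \<and>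
     (\<forall>\<gamma>\<in>set D. \<forall>t. \<gamma> t \<in> \<alpha> \<longrightarrow> \<nu> (\<gamma> t) \<bullet> proj_tangent \<gamma> t = 0)}"

text \<open>The pair (orientation, normal orientation) is right-handed along \<open>\<alpha>\<close>.\<close>

definition right_handed_on ::
    "space set \<Rightarrow> (space \<Rightarrow> plane) \<Rightarrow> (space \<Rightarrow> plane) \<Rightarrow> bool" where
  "right_handed_on \<alpha> \<omega> \<nu> \<longleftrightarrow> (\<forall>x\<in>\<alpha>. det2 (\<omega> x) (\<nu> x) > 0)"

text \<open>
  The vector \<open>n\<close>, placed at the lower crossing point \<open>q\<close>, points from the under-(semi-)arc
  \<open>\<alpha>\<close> to the under-(semi-)arc \<open>\<beta>\<close>: they end at \<open>q\<close> from the negative and from the positive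
  side of \<open>n\<close>. This also makes sense when \<open>\<alpha> = \<beta>\<close>, i.e. when both ends of one
  arc lie at the crossing.
\<close>

definition points_from_to ::
    "space \<Rightarrow> plane \<Rightarrow> space set \<Rightarrow> space set \<Rightarrow> bool" where
  "points_from_to q n \<alpha> \<beta> \<longleftrightarrow>
     q \<in> closure {y \<in> \<alpha>. (plane_proj y - plane_proj q) \<bullet> n < 0} \<and>
     q \<in> closure {y \<in> \<beta>. (plane_proj y - plane_proj q) \<bullet> n > 0}"


section \<open>Colorings of oriented diagrams by a quandle\<close>

definition Col ::
    "'a set \<Rightarrow> ('a \<Rightarrow> 'a \<Rightarrow> 'a) \<Rightarrow> diagram \<Rightarrow> (space \<Rightarrow> plane) \<Rightarrow> (space set \<Rightarrow> 'a) set" where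
  "Col X f D \<omega> = {c \<in> arcs D \<rightarrow>\<^sub>E X.
     \<forall>(p, q)\<in>crossings D. \<forall>\<alpha>\<^sub>1\<in>arcs D. \<forall>\<alpha>\<^sub>2\<in>arcs D. \<forall>\<alpha>\<^sub>3\<in>arcs D. \<forall>\<nu>\<in>normal_orientations D \<alpha>\<^sub>3.
       p \<in> \<alpha>\<^sub>3 \<and> right_handed_on \<alpha>\<^sub>3 \<omega> \<nu> \<and> points_from_to q (\<nu> p) \<alpha>\<^sub>1 \<alpha>\<^sub>2
       \<longrightarrow> f (c \<alpha>\<^sub>1) (c \<alpha>\<^sub>3) = c \<alpha>\<^sub>2}"


section \<open>Colorings of unoriented diagrams by a symmetric quandle\<close>

type_synonym 'a assignment = "space set \<Rightarrow> (space \<Rightarrow> plane) \<times> 'a"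

definition assignments :: "'a set \<Rightarrow> diagram \<Rightarrow> 'a assignment set" where
  "assignments X D = (\<Pi>\<^sub>E \<alpha>\<in>semi_arcs D. normal_orientations D \<alpha> \<times> X)"

text \<open>
  Semi-arcs do not contain crossing points; the value at a crossing point \<open>x\<close> of the normal
  orientation of a semi-arc ending at \<open>x\<close> is its limit there.
\<close>

definition coherent_at ::
    "space \<Rightarrow> 'a assignment \<Rightarrow> space set \<Rightarrow> space set \<Rightarrow> bool" where
  "coherent_at x A \<alpha> \<beta> \<longleftrightarrow>
     (\<exists>n. (fst (A \<alpha>) \<longlongrightarrow> n) (at x within \<alpha>) \<and> (fst (A \<beta>) \<longlongrightarrow> n) (at x within \<beta>))"

definition over_condition :: "('a \<Rightarrow> 'a) \<Rightarrow> diagram \<Rightarrow> 'a assignment \<Rightarrow> bool" where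
  "over_condition \<rho> D A \<longleftrightarrow>
     (\<forall>(p, q)\<in>crossings D. \<forall>\<alpha>\<^sub>1\<in>semi_arcs D. \<forall>\<alpha>\<^sub>2\<in>semi_arcs D.
        p \<in> closure \<alpha>\<^sub>1 \<and> p \<in> closure \<alpha>\<^sub>2 \<longrightarrow>
        (if coherent_at p A \<alpha>\<^sub>1 \<alpha>\<^sub>2 then snd (A \<alpha>\<^sub>1) = snd (A \<alpha>\<^sub>2)
         else snd (A \<alpha>\<^sub>1) = \<rho> (snd (A \<alpha>\<^sub>2))))"

definition under_condition ::
    "('a \<Rightarrow> 'a \<Rightarrow> 'a) \<Rightarrow> ('a \<Rightarrow> 'a) \<Rightarrow> diagram \<Rightarrow> 'a assignment \<Rightarrow> bool" where
  "under_condition f \<rho> D A \<longleftrightarrow>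
     (\<forall>(p, q)\<in>crossings D. \<forall>\<alpha>\<^sub>1\<in>semi_arcs D. \<forall>\<alpha>\<^sub>2\<in>semi_arcs D. \<forall>\<alpha>\<^sub>3\<in>semi_arcs D. \<forall>n.
        p \<in> closure \<alpha>\<^sub>3 \<and> (fst (A \<alpha>\<^sub>3) \<longlongrightarrow> n) (at p within \<alpha>\<^sub>3) \<and> points_from_to q n \<alpha>\<^sub>1 \<alpha>\<^sub>2 \<longrightarrow>
        (if coherent_at q A \<alpha>\<^sub>1 \<alpha>\<^sub>2 then f (snd (A \<alpha>\<^sub>1)) (snd (A \<alpha>\<^sub>3)) = snd (A \<alpha>\<^sub>2)
         else f (snd (A \<alpha>\<^sub>1)) (snd (A \<alpha>\<^sub>3)) = \<rho> (snd (A \<alpha>\<^sub>2))))"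

definition basic_inversion ::
    "'a set \<Rightarrow> ('a \<Rightarrow> 'a) \<Rightarrow> diagram \<Rightarrow> 'a assignment \<Rightarrow> 'a assignment \<Rightarrow> bool" where
  "basic_inversion X \<rho> D A B \<longleftrightarrow> A \<in> assignments X D \<and>
     (\<exists>\<alpha>\<in>semi_arcs D. B = A(\<alpha> := (restrict (\<lambda>x. - fst (A \<alpha>) x) \<alpha>, \<rho> (snd (A \<alpha>)))))"

definition sym_Col ::
    "'a set \<Rightarrow> ('a \<Rightarrow> 'a \<Rightarrow> 'a) \<Rightarrow> ('a \<Rightarrow> 'a) \<Rightarrow> diagram \<Rightarrow> 'a assignment set set" where
  "sym_Col X f \<rho> D = {A \<in> assignments X D. over_condition \<rho> D A \<and> under_condition f \<rho> D A}
     // {(A, B). equivclp (basic_inversion X \<rho> D) A B}"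


section \<open>Canonical forms and induced orientations\<close>

definition Col_double ::
    "'a set \<Rightarrow> ('a \<Rightarrow> 'a \<Rightarrow> 'a) \<Rightarrow> diagram \<Rightarrow> ('a \<times> sign) assignment set set" where
  "Col_double X f D = sym_Col (double_carrier X) (double_op X f) double_inv D"

definition canonical_form ::
    "diagram \<Rightarrow> ('a \<times> sign) assignment set \<Rightarrow> ('a \<times> sign) assignment" where
  "canonical_form D C = (THE A. A \<in> C \<and> (\<forall>\<alpha>\<in>semi_arcs D. snd (snd (A \<alpha>)) = Pos))"

definition induces_orientation ::
    "diagram \<Rightarrow> ('a \<times> sign) assignment set \<Rightarrow> (space \<Rightarrow> plane) \<Rightarrow> bool" where
  "induces_orientation D C \<omega> \<longleftrightarrow> \<omega> \<in> orientations D \<and>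
     (\<forall>\<alpha>\<in>semi_arcs D. right_handed_on \<alpha> \<omega> (fst (canonical_form D C \<alpha>)))"

definition ori_rel ::
    "'a set \<Rightarrow> ('a \<Rightarrow> 'a \<Rightarrow> 'a) \<Rightarrow> diagram \<Rightarrow> ('a \<times> sign) assignment set rel" where
  "ori_rel X f D = {(C, C'). C \<in> Col_double X f D \<and> C' \<in> Col_double X f D \<and>
     (\<exists>\<omega>. induces_orientation D C \<omega> \<and> induces_orientation D C' \<omega>)}"

end

theory Submission
  imports Defs
begin

text \<open>
  The orientation \<open>\<omega>\<close> singles out one of the two normal orientations of every semi-arc,
  namely \<open>\<omega>\<close> rotated by a right angle. A label of an assignment by a symmetric quandle can
  therefore be measured against it: keep the label if the semi-arc carries this normal, and apply
  the involution otherwise. The measured labels do not change under basic inversions, and since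
  there are only finitely many semi-arcs, they determine the assignment up to basic inversions
  (\<open>equivclp_iff_label_eq\<close>). The over- and under-conditions, with their case distinctions on
  coherence, turn into the plain conditions that measured labels agree across over-crossings
  and satisfy \<open>x\<^sub>1 \<triangleright> x\<^sub>3 = x\<^sub>2\<close> at under-crossings
  (\<open>conditions_iff_semi_arc_coloring\<close>). So symmetric colorings are the same as labellings
  of semi-arcs with these two properties.

  For the symmetric double, the canonical form of a class carries the normal given by
  \<open>\<omega>\<close> exactly where the measured label has positive sign. Hence the colorings whose
  canonical form induces \<open>\<omega>\<close> are those whose measured labels all lie in the positive copy
  of \<open>X\<close> (\<open>induces_orientation_iff\<close>), which amounts to a labelling of semi-arcs by
  \<open>X\<close> itself. Such a labelling is constant along each arc, because an arc is connected and
  its semi-arcs only meet at upper crossing points, where labels agree (\<open>constant_on_arcs\<close>);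
  so it is the same as a coloring of the oriented diagram
  (\<open>Col_iff_semi_arc_coloring\<close>, \<open>semi_arc_coloring_extends\<close>).

  The topology enters through three facts about a generic projection: there are finitely
  many semi-arcs, their closures cover the link, and normal orientations extend continuously to
  crossing points.
\<close>

section \<open>Connected components of finite unions\<close>

lemma finite_components_Union_connected:
  assumes "finite \<K>" "\<And>K. K \<in> \<K> \<Longrightarrow> connected K"
  shows "finite (components (\<Union>\<K>))"
proof -
  \<comment> \<open>Every component contains some \<open>K\<close>, so it is the component of a point of \<open>K\<close>.\<close>
  define h where "h K = connected_component_set (\<Union>\<K>) (SOME x. x \<in> K)" for K
  have "c \<in> h ` \<K>" if c: "c \<in> components (\<Union>\<K>)" for c
  proof -
    obtain x where x: "x \<in> \<Union>\<K>" "c = connected_component_set (\<Union>\<K>) x"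
      using c by (meson componentsE)
    then obtain K where K: "K \<in> \<K>" "x \<in> K" by blast
    then have "K \<subseteq> c"
      using connected_component_maximal[of x K "\<Union>\<K>"] assms(2) x(2) by blast
    moreover have "(SOME y. y \<in> K) \<in> K" using K(2) by (rule someI)
    ultimately have "h K = c"
      unfolding h_def using x(2) connected_component_eq by blast
    with K show ?thesis by blast
  qed
  then show ?thesis using assms(1) by (meson finite_surj subsetI)
qed

text \<open>
  Deleting one point \<open>a\<close> cuts each piece into its parts below and above \<open>a\<close>.
\<close>

lemma real_minus_finite_connected_pieces:
  fixes S F :: "real set"
  assumes "finite F" "connected S"
  shows "\<exists>\<K>. finite \<K> \<and> (\<forall>K\<in>\<K>. connected K) \<and> S - F = \<Union>\<K>"
  using assms(1)
proof (induction F)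
  case empty
  show ?case using assms(2) by (intro exI[of _ "{S}"]) auto
next
  case (insert a F)
  then obtain \<K> where K: "finite \<K>" "\<forall>K\<in>\<K>. connected K" "S - F = \<Union>\<K>" by blast
  let ?L = "(\<lambda>K. K \<inter> {..<a}) ` \<K> \<union> (\<lambda>K. K \<inter> {a<..}) ` \<K>"
  have "connected K'" if "K' \<in> ?L" for K'
    using that K(2) by (auto simp flip: is_interval_connected_1 intro!: is_interval_Int)
  moreover have "S - insert a F = \<Union>?L"
  proof -
    have "S - insert a F = \<Union>\<K> - {a}" using K(3) by blast
    also have "\<dots> = \<Union>?L" by (auto simp: neq_iff)
    finally show ?thesis .
  qed
  ultimately show ?case using K(1) by (intro exI[of _ ?L]) auto
qed

text \<open>
  The union of the closures carrying one value of \<open>g\<close> and the union of the others are two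
  closed sets that cover \<open>S\<close> and are disjoint inside \<open>S\<close>. This replaces the usual
  argument that follows a strand from one crossing to the next, and so avoids parametrising arcs.
\<close>

lemma connected_finite_closed_cover_constant:
  fixes S :: "'a::topological_space set"
  assumes "connected S" "finite \<A>" "S \<subseteq> (\<Union>A\<in>\<A>. closure A)"
    and eq: "\<And>A B x. \<lbrakk>A \<in> \<A>; B \<in> \<A>; x \<in> S; x \<in> closure A; x \<in> closure B\<rbrakk> \<Longrightarrow> g A = g B"
    and A: "A \<in> \<A>" "S \<inter> closure A \<noteq> {}" and B: "B \<in> \<A>" "S \<inter> closure B \<noteq> {}"
  shows "g A = g B"
proof (rule ccontr)
  assume ne: "g A \<noteq> g B"
  let ?U = "\<Union>(closure ` {K\<in>\<A>. g K = g A})" and ?V = "\<Union>(closure ` {K\<in>\<A>. g K \<noteq> g A})"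
  have "closed ?U" "closed ?V" using assms(2) by (auto intro!: closed_Union)
  moreover have "S \<subseteq> ?U \<union> ?V" using assms(3) by blast
  moreover have "?U \<inter> ?V \<inter> S = {}"
  proof (rule equals0I)
    fix x assume "x \<in> ?U \<inter> ?V \<inter> S"
    then obtain K L where "K \<in> \<A>" "g K = g A" "x \<in> closure K" "L \<in> \<A>" "g L \<noteq> g A"
      "x \<in> closure L" "x \<in> S"
      by blast
    then show False using eq[of K L x] by simp
  qed
  moreover have "?U \<inter> S \<noteq> {}" using A by blast
  moreover have "?V \<inter> S \<noteq> {}" using B ne by fastforce
  ultimately show False using \<open>connected S\<close> connected_closedD[of S ?U ?V] by blast
qed

lemma component_relatively_closed:
  assumes "C \<in> components S" "x \<in> S" "x \<in> closure C"
  shows "x \<in> C"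
  using closedin_component[OF assms(1)] assms(2,3)
  by (metis Int_iff closedin_closed closure_minimal in_mono inf.cobounded2)

lemma closure_finite_UN:
  "finite I \<Longrightarrow> closure (\<Union>i\<in>I. A i) = (\<Union>i\<in>I. closure (A i))"
  by (induction I rule: finite_induct) auto

section \<open>Plane geometry\<close>

text \<open>
  Rotation by a right angle counterclockwise: for \<open>u \<noteq> 0\<close>, \<open>v = quarter_turn u\<close> is
  the unique vector of the same length, orthogonal to \<open>u\<close>, that makes \<open>(u, v)\<close> a right-handed pair.
\<close>

definition quarter_turn :: "plane \<Rightarrow> plane" where
  "quarter_turn u = vector [- (u $ 2), u $ 1]"

lemma quarter_turn_nth [simp]: "quarter_turn u $ 1 = - (u $ 2)" "quarter_turn u $ 2 = u $ 1"
  by (simp_all add: quarter_turn_def)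

lemma plane_eq_iff: "(u::plane) = v \<longleftrightarrow> u $ 1 = v $ 1 \<and> u $ 2 = v $ 2"
  by (simp add: vec_eq_iff forall_2)

lemma plane_inner: "(u::plane) \<bullet> v = u $ 1 * v $ 1 + u $ 2 * v $ 2"
  by (simp add: inner_vec_def sum_2)

lemma bounded_linear_quarter_turn: "bounded_linear quarter_turn"
  by (intro linear_conv_bounded_linear[THEN iffD1] linearI) (simp_all add: plane_eq_iff)

lemma norm_quarter_turn [simp]: "norm (quarter_turn u) = norm u"
  by (simp add: norm_eq_sqrt_inner plane_inner)

lemma quarter_turn_orthogonal [simp]: "quarter_turn u \<bullet> u = 0"
  by (simp add: plane_inner)

lemma det2_eq_quarter_turn: "det2 u v = v \<bullet> quarter_turn u"
  by (simp add: det2_def det_2 plane_inner)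

lemma quarter_turn_inject: "quarter_turn u = quarter_turn v \<longleftrightarrow> u = v"
  by (auto simp: plane_eq_iff)

lemma unit_orthogonal_cases:
  assumes "norm u = 1" "norm v = 1" "v \<bullet> u = 0"
  shows "v = (v \<bullet> quarter_turn u) *\<^sub>R quarter_turn u"
    and "v \<bullet> quarter_turn u = 1 \<or> v \<bullet> quarter_turn u = -1"
proof -
  have uu: "u $ 1 * u $ 1 + u $ 2 * u $ 2 = 1" and vv: "v $ 1 * v $ 1 + v $ 2 * v $ 2 = 1"
    and vu: "v $ 1 * u $ 1 + v $ 2 * u $ 2 = 0"
    using assms by (simp_all add: norm_eq_1 plane_inner)
  have "v $ 1 = - (v $ 2 * u $ 1 - v $ 1 * u $ 2) * u $ 2"
    "v $ 2 = (v $ 2 * u $ 1 - v $ 1 * u $ 2) * u $ 1"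
    using uu vu by algebra+
  then show 1: "v = (v \<bullet> quarter_turn u) *\<^sub>R quarter_turn u"
    unfolding plane_eq_iff plane_inner vector_scaleR_component quarter_turn_nth real_scaleR_def
    by argo
  have "\<bar>v \<bullet> quarter_turn u\<bar> = 1"
    using arg_cong[OF 1, of norm] assms by simp
  then show "v \<bullet> quarter_turn u = 1 \<or> v \<bullet> quarter_turn u = -1" by arith
qed

section \<open>Points, arcs and semi-arcs of a link diagram\<close>

definition crossing_points :: "diagram \<Rightarrow> space set" where
  "crossing_points D = fst ` crossings D \<union> snd ` crossings D"

lemma semi_arcs_eq: "semi_arcs D = components (link_points D - crossing_points D)"
  by (simp add: semi_arcs_def crossing_points_def)

locale oriented_diagram =
  fixes D :: diagram and \<omega> :: "space \<Rightarrow> plane"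
  assumes diagram: "link_diagram D" and orientation: "\<omega> \<in> orientations D"
begin

lemma finite_crossing_points: "finite (crossing_points D)"
  using diagram by (simp add: crossing_points_def link_diagram_def generic_projection_def)

lemma crossing_points_in_link: "(p, q) \<in> crossings D \<Longrightarrow> p \<in> link_points D \<and> q \<in> link_points D"
  by (simp add: crossings_def)

lemma crossing_pointsI:
  assumes "(p, q) \<in> crossings D"
  shows "p \<in> crossing_points D" "q \<in> crossing_points D"
  using assms by (force simp: crossing_points_def)+

text \<open>
  A point lying over one point and under another would give a triple point of the projection.
\<close>

lemma upper_not_lower:
  assumes "(p, q) \<in> crossings D"
  shows "p \<notin> snd ` crossings D"
proof
  assume "p \<in> snd ` crossings D"
  then obtain r where r: "(r, p) \<in> crossings D" by auto
  let ?F = "{x \<in> link_points D. plane_proj x = plane_proj p}"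
  have "{r, p, q} \<subseteq> ?F" "r \<noteq> p" "p \<noteq> q" "r \<noteq> q"
    using assms r by (auto simp: crossings_def)
  moreover have "finite ?F" "card ?F \<le> 2"
    using diagram by (auto simp: link_diagram_def generic_projection_def)
  ultimately show False using card_mono[of ?F "{r, p, q}"] by simp
qed

lemma continuous_component:
  assumes "\<gamma> \<in> set D"
  shows "continuous_on S \<gamma>"
  using assms diagram C1_differentiable_imp_continuous_on continuous_on_subset
  by (metis link_diagram_def link_def subset_UNIV)

lemma component_eq_imp_Ints:
  assumes "\<gamma> \<in> set D" "\<gamma> s = \<gamma> t"
  shows "s - t \<in> \<int>"
  using assms diagram by (auto simp: link_diagram_def link_def in_set_conv_nth)

lemma component_periodic:
  assumes "\<gamma> \<in> set D"
  shows "\<gamma> (t + of_int n) = \<gamma> t"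
proof -
  have step: "\<gamma> (s + 1) = \<gamma> s" for s
    using assms diagram by (auto simp: link_diagram_def link_def)
  show ?thesis
  proof (induction n rule: int_induct[where k = 0])
    case (step1 i)
    then show ?case using step[of "t + of_int i"] by (simp add: add.assoc)
  next
    case (step2 i)
    then show ?case using step[of "t + of_int (i - 1)"] by (simp add: algebra_simps)
  qed simp
qed

lemma range_component:
  assumes "\<gamma> \<in> set D"
  shows "range \<gamma> = \<gamma> ` {0..<1}"
proof -
  have "\<gamma> t = \<gamma> (frac t)" for t
    using component_periodic[OF assms, of "frac t" "\<lfloor>t\<rfloor>"] by (simp add: frac_def)
  moreover have "frac t \<in> {0..<1}" for t :: real by (simp add: frac_ge_0 frac_lt_1)
  ultimately show ?thesis by blast
qed

lemma inj_on_component: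
  assumes "\<gamma> \<in> set D"
  shows "inj_on \<gamma> {0..<1}"
proof (rule inj_onI)
  fix s t :: real
  assume st: "s \<in> {0..<1}" "t \<in> {0..<1}" "\<gamma> s = \<gamma> t"
  obtain k where k: "s - t = of_int k"
    using component_eq_imp_Ints[OF assms st(3)] by (auto elim: Ints_cases)
  moreover have "\<bar>s - t\<bar> < 1" using st(1,2) by auto
  ultimately have "k = 0" by linarith
  with k show "s = t" by simp
qed

text \<open>
  Each component of the link is an injective image of a half-open unit interval, and the finitely
  many crossing points cut this interval into finitely many connected pieces. Finiteness is what
  allows any two assignments with the same labels to be joined by finitely many basic inversions,
  and what makes the union of the closures of semi-arcs closed.
\<close>

lemma finite_semi_arcs: "finite (semi_arcs D)"
proof -
  have pieces: "\<exists>\<K>. finite \<K> \<and> (\<forall>K\<in>\<K>. connected K) \<and> range \<gamma> - crossing_points D = \<Union>\<K>"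
    if \<gamma>: "\<gamma> \<in> set D" for \<gamma>
  proof -
    let ?F = "\<gamma> -` crossing_points D \<inter> {0..<1}"
    have "finite ?F"
      using finite_crossing_points inj_on_component[OF \<gamma>] by (rule finite_vimage_IntI)
    moreover have "connected {0..<1::real}" by simp
    ultimately obtain \<K> where K: "finite \<K>" "\<forall>K\<in>\<K>. connected K" "{0..<1} - ?F = \<Union>\<K>"
      using real_minus_finite_connected_pieces by metis
    have "range \<gamma> - crossing_points D = \<gamma> ` ({0..<1} - ?F)"
      using range_component[OF \<gamma>] by auto
    also have "\<dots> = \<Union>((`) \<gamma> ` \<K>)" using K(3) by auto
    finally show ?thesis
      using K(1,2) continuous_component[OF \<gamma>] 
      by (intro exI[of _ "(`) \<gamma> ` \<K>"]) (auto intro: connected_continuous_image)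
  qed
  then obtain \<K> where K: "\<forall>\<gamma>\<in>set D. finite (\<K> \<gamma>) \<and> (\<forall>K\<in>\<K> \<gamma>. connected K) \<and>
      range \<gamma> - crossing_points D = \<Union>(\<K> \<gamma>)"
    by metis
  have "link_points D - crossing_points D = \<Union>(\<Union>\<gamma>\<in>set D. \<K> \<gamma>)"
  proof -
    have "link_points D - crossing_points D = (\<Union>\<gamma>\<in>set D. range \<gamma> - crossing_points D)"
      unfolding link_points_def by blast
    also have "\<dots> = (\<Union>\<gamma>\<in>set D. \<Union>(\<K> \<gamma>))" using K by (intro SUP_cong) auto
    finally show ?thesis by blast
  qed
  moreover have "finite (components (\<Union>(\<Union>\<gamma>\<in>set D. \<K> \<gamma>)))"
    using K by (intro finite_components_Union_connected) blast+
  ultimately show ?thesis unfolding semi_arcs_eq by simp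
qed

lemma link_point_islimpt:
  assumes "x \<in> link_points D"
  shows "x islimpt link_points D"
proof -
  obtain \<gamma> where \<gamma>: "\<gamma> \<in> set D" "x \<in> range \<gamma>"
    using assms by (auto simp: link_points_def)
  have "\<gamma> 0 \<noteq> \<gamma> (1/2)"
    using component_eq_imp_Ints[OF \<gamma>(1), of "1/2" 0] by (auto elim: Ints_cases)
  then have "\<nexists>a. range \<gamma> = {a}" by (metis rangeI singletonD)
  then have "x islimpt range \<gamma>"
    using continuous_component[OF \<gamma>(1)] \<gamma>(2)
    by (intro connected_imp_perfect connected_continuous_image) auto
  moreover have "range \<gamma> \<subseteq> link_points D" using \<gamma>(1) by (auto simp: link_points_def)
  ultimately show ?thesis by (rule islimpt_subset)
qed

text \<open>
  The link has no isolated points, so a crossing point is a limit of points that lie on semi-arcs,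
  and one of the finitely many semi-arcs must accumulate at it.
\<close>

lemma link_points_subset_closure_semi_arcs: "link_points D \<subseteq> (\<Union>\<alpha>\<in>semi_arcs D. closure \<alpha>)"
proof
  fix x assume "x \<in> link_points D"
  then have "x islimpt (crossing_points D \<union> (link_points D - crossing_points D))"
    using link_point_islimpt by (metis Un_Diff_cancel islimpt_Un)
  then have "x islimpt (\<Union>\<alpha>\<in>semi_arcs D. \<alpha>)"
    unfolding islimpt_Un_finite[OF finite_crossing_points] by (simp add: semi_arcs_eq)
  then show "x \<in> (\<Union>\<alpha>\<in>semi_arcs D. closure \<alpha>)"
    unfolding islimpt_finite_union_iff[OF finite_semi_arcs] by (auto simp: closure_def)
qed

lemma semi_arc_props:
  assumes "\<alpha> \<in> semi_arcs D"
  shows "\<alpha> \<noteq> {}" "connected \<alpha>" "\<alpha> \<subseteq> link_points D" "\<alpha> \<inter> crossing_points D = {}"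
  using in_components_nonempty[OF assms[unfolded semi_arcs_eq]]
    in_components_connected[OF assms[unfolded semi_arcs_eq]]
    in_components_subset[OF assms[unfolded semi_arcs_eq]]
  by blast+

lemma arc_props:
  assumes "a \<in> arcs D"
  shows "a \<noteq> {}" "connected a" "a \<subseteq> link_points D" "a \<inter> snd ` crossings D = {}"
  using in_components_nonempty[OF assms[unfolded arcs_def]]
    in_components_connected[OF assms[unfolded arcs_def]]
    in_components_subset[OF assms[unfolded arcs_def]]
  by blast+

definition arc_of :: "space set \<Rightarrow> space set" where
  "arc_of \<alpha> = (THE a. a \<in> arcs D \<and> \<alpha> \<subseteq> a)"

lemma arc_of_eqI:
  assumes "\<alpha> \<in> semi_arcs D" "a \<in> arcs D" "\<alpha> \<inter> a \<noteq> {}"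
  shows "arc_of \<alpha> = a"
proof -
  have sub: "\<alpha> \<subseteq> link_points D - snd ` crossings D"
    using semi_arc_props[OF assms(1)] by (auto simp: crossing_points_def)
  then have "\<alpha> \<subseteq> a"
    using components_maximal[of a _ \<alpha>] assms semi_arc_props(2) unfolding arcs_def by blast
  moreover have "b = a" if "b \<in> arcs D" "\<alpha> \<subseteq> b" for b
  proof -
    have "b \<inter> a \<noteq> {}" using that(2) assms(3) by blast
    then show ?thesis
      using components_eq[OF that(1)[unfolded arcs_def] assms(2)[unfolded arcs_def]] by simp
  qed
  ultimately show ?thesis unfolding arc_of_def using assms(2) by (intro the_equality) blast+
qed

lemma arc_of:
  assumes "\<alpha> \<in> semi_arcs D"
  shows "arc_of \<alpha> \<in> arcs D" "\<alpha> \<subseteq> arc_of \<alpha>"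
proof -
  have sub: "\<alpha> \<subseteq> link_points D - snd ` crossings D"
    using semi_arc_props[OF assms] by (auto simp: crossing_points_def)
  then obtain a where a: "a \<in> arcs D" "\<alpha> \<subseteq> a"
    using exists_component_superset[OF sub] semi_arc_props[OF assms] unfolding arcs_def by blast
  then have "arc_of \<alpha> = a" using semi_arc_props(1)[OF assms] assms by (intro arc_of_eqI) auto
  with a show "arc_of \<alpha> \<in> arcs D" "\<alpha> \<subseteq> arc_of \<alpha>" by simp_all
qed

text \<open>
  Arcs are relatively closed in the complement of the lower crossing points, so a semi-arc
  accumulating at a point of \<open>a\<close> already lies in \<open>a\<close>.
\<close>

lemma arc_of_eq_if_closure_meets:
  assumes "\<alpha> \<in> semi_arcs D" "a \<in> arcs D" "x \<in> a" "x \<in> closure \<alpha>"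
  shows "arc_of \<alpha> = a"
proof -
  have "x \<in> link_points D - snd ` crossings D"
    using arc_props(3,4)[OF assms(2)] assms(3) by blast
  moreover have "x \<in> closure (arc_of \<alpha>)"
    using assms(4) closure_mono[OF arc_of(2)[OF assms(1)]] by blast
  ultimately have "x \<in> arc_of \<alpha>"
    by (rule component_relatively_closed[OF arc_of(1)[OF assms(1), unfolded arcs_def]])
  then have "a \<inter> arc_of \<alpha> \<noteq> {}" using assms(3) by blast
  then show ?thesis
    using components_eq[OF assms(2)[unfolded arcs_def] arc_of(1)[OF assms(1), unfolded arcs_def]]
    by simp
qed

lemma arc_meets_semi_arc_closure:
  assumes "a \<in> arcs D" "x \<in> a"
  obtains \<alpha> where "\<alpha> \<in> semi_arcs D" "x \<in> closure \<alpha>" "arc_of \<alpha> = a"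
proof -
  have "x \<in> (\<Union>\<alpha>\<in>semi_arcs D. closure \<alpha>)"
    using link_points_subset_closure_semi_arcs arc_props(3)[OF assms(1)] assms(2) by (meson subsetD)
  then obtain \<alpha> where "\<alpha> \<in> semi_arcs D" "x \<in> closure \<alpha>" by blast
  with that show thesis using arc_of_eq_if_closure_meets[OF _ assms] by simp
qed

lemma semi_arcs_closure_meet:
  assumes "\<alpha> \<in> semi_arcs D" "\<beta> \<in> semi_arcs D" "x \<in> closure \<alpha>" "x \<in> closure \<beta>"
    "x \<in> link_points D" "x \<notin> crossing_points D"
  shows "\<alpha> = \<beta>"
proof -
  have x: "x \<in> link_points D - crossing_points D" using assms(5,6) by simp
  note comp = assms(1,2)[unfolded semi_arcs_eq]
  have "x \<in> \<alpha>" "x \<in> \<beta>"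
    using component_relatively_closed[OF comp(1) x assms(3)]
      component_relatively_closed[OF comp(2) x assms(4)] .
  then have "\<alpha> \<inter> \<beta> \<noteq> {}" by blast
  then show ?thesis using components_eq[OF comp] by simp
qed

text \<open>
  An arc is connected and covered by the closures of its semi-arcs. Two different semi-arcs can
  only accumulate at a common point of the arc if that is an upper crossing point, where
  \<open>g\<close> is assumed not to jump.
\<close>

lemma constant_on_arcs:
  assumes over: "\<And>p q \<alpha> \<beta>. \<lbrakk>(p, q) \<in> crossings D; \<alpha> \<in> semi_arcs D; \<beta> \<in> semi_arcs D;
      p \<in> closure \<alpha>; p \<in> closure \<beta>\<rbrakk> \<Longrightarrow> g \<alpha> = g \<beta>"
    and \<alpha>: "\<alpha> \<in> semi_arcs D" and \<beta>: "\<beta> \<in> semi_arcs D" and same: "arc_of \<alpha> = arc_of \<beta>"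
  shows "g \<alpha> = g \<beta>"
proof (rule connected_finite_closed_cover_constant[where S = "arc_of \<alpha>" and \<A> = "semi_arcs D"])
  note a = arc_of(1)[OF \<alpha>]
  show "connected (arc_of \<alpha>)" by (rule arc_props(2)[OF a])
  show "arc_of \<alpha> \<subseteq> (\<Union>\<alpha>\<in>semi_arcs D. closure \<alpha>)"
    using arc_props(3)[OF a] link_points_subset_closure_semi_arcs by blast
  show "g \<sigma> = g \<tau>" if st: "\<sigma> \<in> semi_arcs D" "\<tau> \<in> semi_arcs D" and x: "x \<in> arc_of \<alpha>"
    and cl: "x \<in> closure \<sigma>" "x \<in> closure \<tau>" for \<sigma> \<tau> x
  proof (cases "x \<in> crossing_points D")
    case True
    then have "x \<in> fst ` crossings D"
      using arc_props(4)[OF a] x unfolding crossing_points_def by blast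
    then obtain q where "(x, q) \<in> crossings D" by force
    then show ?thesis using over st cl by blast
  next
    case False
    moreover have "x \<in> link_points D" using arc_props(3)[OF a] x by blast
    ultimately show ?thesis using semi_arcs_closure_meet[OF st cl] by simp
  qed
  show "arc_of \<alpha> \<inter> closure \<alpha> \<noteq> {}"
    using arc_of(2)[OF \<alpha>] semi_arc_props(1)[OF \<alpha>] closure_subset[of \<alpha>] by blast
  show "arc_of \<alpha> \<inter> closure \<beta> \<noteq> {}"
    unfolding same using arc_of(2)[OF \<beta>] semi_arc_props(1)[OF \<beta>] closure_subset[of \<beta>] by blast
qed (rule \<alpha> \<beta> finite_semi_arcs)+

text \<open>
  An arc exceeds the union of its semi-arcs by finitely many upper crossing points, none of which
  equals \<open>q\<close>; hence whatever part of the arc accumulates at \<open>q\<close> does so along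
  a single semi-arc. With it the side of the over-arc on which an under-arc ends can be read off
  from an under-semi-arc.
\<close>

lemma semi_arc_approaching:
  assumes a: "a \<in> arcs D" and q: "q \<in> snd ` crossings D" "q \<in> closure {y \<in> a. P y}"
  obtains \<alpha> where "\<alpha> \<in> semi_arcs D" "arc_of \<alpha> = a" "q \<in> closure {y \<in> \<alpha>. P y}"
proof -
  let ?F = "crossing_points D \<inter> a"
  have "{y \<in> a. P y} \<subseteq> ?F \<union> (\<Union>\<alpha>\<in>{\<alpha>\<in>semi_arcs D. arc_of \<alpha> = a}. {y \<in> \<alpha>. P y})"
  proof
    fix y assume y: "y \<in> {y \<in> a. P y}"
    show "y \<in> ?F \<union> (\<Union>\<alpha>\<in>{\<alpha>\<in>semi_arcs D. arc_of \<alpha> = a}. {y \<in> \<alpha>. P y})"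
    proof (cases "y \<in> crossing_points D")
      case False
      then have "y \<in> \<Union>(semi_arcs D)"
        using y arc_props(3)[OF a] unfolding semi_arcs_eq Union_components by blast
      then obtain \<alpha> where "\<alpha> \<in> semi_arcs D" "y \<in> \<alpha>" by blast
      then show ?thesis using y arc_of_eqI[of \<alpha>, OF _ a] by blast
    qed (use y in blast)
  qed
  then have "closure {y \<in> a. P y}
      \<subseteq> closure (?F \<union> (\<Union>\<alpha>\<in>{\<alpha>\<in>semi_arcs D. arc_of \<alpha> = a}. {y \<in> \<alpha>. P y}))"
    by (rule closure_mono)
  also have "\<dots> = ?F \<union> (\<Union>\<alpha>\<in>{\<alpha>\<in>semi_arcs D. arc_of \<alpha> = a}. closure {y \<in> \<alpha>. P y})"
    using finite_crossing_points finite_semi_arcs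
    by (simp add: closure_finite_UN closure_closed finite_imp_closed)
  finally have "q \<in> ?F \<union> (\<Union>\<alpha>\<in>{\<alpha>\<in>semi_arcs D. arc_of \<alpha> = a}. closure {y \<in> \<alpha>. P y})"
    using q(2) by (rule subsetD)
  moreover have "q \<notin> a" using q(1) arc_props(4)[OF a] by blast
  ultimately show ?thesis using that by blast
qed

section \<open>Normal orientations of an oriented diagram\<close>

lemma continuous_on_orientation: "continuous_on (link_points D) \<omega>"
  using orientation by (simp add: orientations_def)

lemma norm_orientation: "x \<in> link_points D \<Longrightarrow> norm (\<omega> x) = 1"
  using orientation by (auto simp: orientations_def)

lemma orientation_tangent:
  assumes "\<gamma> \<in> set D"
  obtains r where "r \<noteq> 0" "\<omega> (\<gamma> t) = r *\<^sub>R proj_tangent \<gamma> t"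
proof -
  obtain r where r: "\<omega> (\<gamma> t) = r *\<^sub>R proj_tangent \<gamma> t"
    using orientation assms unfolding orientations_def by blast
  moreover have "\<gamma> t \<in> link_points D" using assms by (auto simp: link_points_def)
  then have "norm (\<omega> (\<gamma> t)) = 1" by (rule norm_orientation)
  then have "r \<noteq> 0" using r by auto
  ultimately show thesis using that by blast
qed

definition right_normal :: "space set \<Rightarrow> space \<Rightarrow> plane" where
  "right_normal \<alpha> = (\<lambda>x\<in>\<alpha>. quarter_turn (\<omega> x))"

definition left_normal :: "space set \<Rightarrow> space \<Rightarrow> plane" where
  "left_normal \<alpha> = (\<lambda>x\<in>\<alpha>. - quarter_turn (\<omega> x))"

lemma reverse_normal:
  "(\<lambda>x\<in>\<alpha>. - right_normal \<alpha> x) = left_normal \<alpha>" "(\<lambda>x\<in>\<alpha>. - left_normal \<alpha> x) = right_normal \<alpha>"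
  by (auto simp: right_normal_def left_normal_def)

lemma left_normal_neq_right_normal:
  assumes "\<alpha> \<noteq> {}" "\<alpha> \<subseteq> link_points D"
  shows "left_normal \<alpha> \<noteq> right_normal \<alpha>"
proof
  assume eq: "left_normal \<alpha> = right_normal \<alpha>"
  obtain x where x: "x \<in> \<alpha>" using assms(1) by blast
  have "- quarter_turn (\<omega> x) = quarter_turn (\<omega> x)"
    using fun_cong[OF eq, of x] x by (simp add: right_normal_def left_normal_def)
  then have "quarter_turn (\<omega> x) = 0" by (simp add: plane_eq_iff)
  then have "norm (\<omega> x) = 0" by (metis norm_quarter_turn norm_zero)
  moreover have "norm (\<omega> x) = 1" using x assms(2) by (intro norm_orientation) blast
  ultimately show False by simp
qed

lemma continuous_on_quarter_turn_orientation:
  "continuous_on (link_points D) (\<lambda>x. quarter_turn (\<omega> x))"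
  by (intro bounded_linear.continuous_on[OF bounded_linear_quarter_turn] continuous_on_orientation)

lemma normal_orientation_orthogonal:
  assumes "\<nu> \<in> normal_orientations D \<alpha>" "\<alpha> \<subseteq> link_points D" "x \<in> \<alpha>"
  shows "norm (\<nu> x) = 1" "\<nu> x \<bullet> \<omega> x = 0"
proof -
  show "norm (\<nu> x) = 1" using assms(1,3) by (auto simp: normal_orientations_def)
  obtain \<gamma> t where \<gamma>: "\<gamma> \<in> set D" "x = \<gamma> t" using assms(2,3) by (auto simp: link_points_def)
  obtain r where "\<omega> x = r *\<^sub>R proj_tangent \<gamma> t" using orientation_tangent[OF \<gamma>(1), of t] \<gamma>(2) by metis
  moreover have "\<nu> x \<bullet> proj_tangent \<gamma> t = 0"
    using assms(1,3) \<gamma> by (auto simp: normal_orientations_def)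
  ultimately show "\<nu> x \<bullet> \<omega> x = 0" by simp
qed

lemma right_left_normal_in:
  assumes "\<alpha> \<subseteq> link_points D"
  shows "right_normal \<alpha> \<in> normal_orientations D \<alpha>" "left_normal \<alpha> \<in> normal_orientations D \<alpha>"
proof -
  have cont: "continuous_on \<alpha> (\<lambda>x. quarter_turn (\<omega> x))"
    using continuous_on_quarter_turn_orientation assms by (rule continuous_on_subset)
  have unit: "norm (quarter_turn (\<omega> x)) = 1" if "x \<in> \<alpha>" for x
    using norm_orientation assms that by auto
  have orth: "quarter_turn (\<omega> (\<gamma> t)) \<bullet> proj_tangent \<gamma> t = 0" if \<gamma>: "\<gamma> \<in> set D" for \<gamma> t
  proof -
    obtain r where r: "r \<noteq> 0" "\<omega> (\<gamma> t) = r *\<^sub>R proj_tangent \<gamma> t" by (rule orientation_tangent[OF \<gamma>])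
    have "r * (quarter_turn (\<omega> (\<gamma> t)) \<bullet> proj_tangent \<gamma> t) = quarter_turn (\<omega> (\<gamma> t)) \<bullet> \<omega> (\<gamma> t)"
      by (subst (2) r(2)) simp
    with r(1) show ?thesis by simp
  qed
  have "continuous_on \<alpha> (right_normal \<alpha>) \<longleftrightarrow> continuous_on \<alpha> (\<lambda>x. quarter_turn (\<omega> x))"
    by (intro continuous_on_cong) (simp_all add: right_normal_def)
  then show "right_normal \<alpha> \<in> normal_orientations D \<alpha>"
    using cont unit orth by (auto simp: normal_orientations_def right_normal_def)
  have "continuous_on \<alpha> (left_normal \<alpha>) \<longleftrightarrow> continuous_on \<alpha> (\<lambda>x. - quarter_turn (\<omega> x))"
    by (intro continuous_on_cong) (simp_all add: left_normal_def)
  then show "left_normal \<alpha> \<in> normal_orientations D \<alpha>"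
    using continuous_on_minus[OF cont] unit orth by (auto simp: normal_orientations_def left_normal_def)
qed

text \<open>
  A unit normal is \<open>quarter_turn \<circ> \<omega>\<close> up to a sign at each point; the sign is
  continuous with finite range, hence constant on a connected set.
\<close>

lemma normal_orientation_cases:
  assumes \<nu>: "\<nu> \<in> normal_orientations D \<alpha>" and \<alpha>: "connected \<alpha>" "\<alpha> \<subseteq> link_points D"
  shows "\<nu> = right_normal \<alpha> \<or> \<nu> = left_normal \<alpha>"
proof -
  define s where "s x = \<nu> x \<bullet> quarter_turn (\<omega> x)" for x
  have s: "\<nu> x = s x *\<^sub>R quarter_turn (\<omega> x)" "s x = 1 \<or> s x = -1" if "x \<in> \<alpha>" for x
    using unit_orthogonal_cases[of "\<omega> x" "\<nu> x"] normal_orientation_orthogonal[OF \<nu> \<alpha>(2) that]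
      norm_orientation[of x] \<alpha>(2) that
    unfolding s_def by auto
  have "continuous_on \<alpha> s"
    unfolding s_def using \<nu> continuous_on_subset[OF continuous_on_quarter_turn_orientation \<alpha>(2)]
    by (intro continuous_on_inner) (auto simp: normal_orientations_def)
  moreover have "finite (s ` \<alpha>)"
    by (rule finite_subset[of _ "{1, -1}"]) (use s(2) in auto)
  ultimately obtain e where e: "\<And>x. x \<in> \<alpha> \<Longrightarrow> s x = e"
    using continuous_finite_range_constant[OF \<alpha>(1)] unfolding constant_on_def by metis
  have ext: "\<nu> \<in> extensional \<alpha>" using \<nu> by (simp add: normal_orientations_def PiE_def)
  show ?thesis
  proof (cases "e = 1")
    case True
    then have "\<nu> = right_normal \<alpha>"
      using s(1) e ext by (intro extensionalityI[of _ \<alpha>]) (auto simp: right_normal_def)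
    then show ?thesis ..
  next
    case False
    then have "\<nu> = left_normal \<alpha>"
      using s e ext by (intro extensionalityI[of _ \<alpha>]) (fastforce simp: left_normal_def)+
    then show ?thesis ..
  qed
qed

lemma right_handed_on_iff:
  assumes \<nu>: "\<nu> \<in> normal_orientations D \<alpha>" and \<alpha>: "\<alpha> \<subseteq> link_points D"
  shows "right_handed_on \<alpha> \<omega> \<nu> \<longleftrightarrow> \<nu> = right_normal \<alpha>"
proof
  assume "\<nu> = right_normal \<alpha>"
  moreover have "quarter_turn (\<omega> x) \<bullet> quarter_turn (\<omega> x) = 1" if "x \<in> \<alpha>" for x
    using norm_orientation[of x] \<alpha> that by (simp flip: norm_eq_1) blast
  ultimately show "right_handed_on \<alpha> \<omega> \<nu>"
    by (simp add: right_handed_on_def det2_eq_quarter_turn right_normal_def)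
next
  assume rh: "right_handed_on \<alpha> \<omega> \<nu>"
  have "\<nu> x = quarter_turn (\<omega> x)" if x: "x \<in> \<alpha>" for x
  proof -
    have "\<nu> x \<bullet> quarter_turn (\<omega> x) > 0"
      using rh x by (simp add: right_handed_on_def det2_eq_quarter_turn)
    moreover have "norm (\<omega> x) = 1" using norm_orientation x \<alpha> by blast
    note unit_orthogonal_cases[OF this normal_orientation_orthogonal[OF \<nu> \<alpha> x]]
    ultimately show ?thesis by (metis less_minus_one_simps(1) less_not_sym scaleR_one)
  qed
  moreover have "\<nu> \<in> extensional \<alpha>" using \<nu> by (simp add: normal_orientations_def PiE_def)
  ultimately show "\<nu> = right_normal \<alpha>"
    by (intro extensionalityI[of _ \<alpha>]) (auto simp: right_normal_def)
qed

lemma semi_arc_normal_cases: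
  assumes "\<alpha> \<in> semi_arcs D" "\<nu> \<in> normal_orientations D \<alpha>"
  shows "\<nu> = right_normal \<alpha> \<or> \<nu> = left_normal \<alpha>"
  using normal_orientation_cases assms semi_arc_props by blast

lemma semi_arc_normals_distinct:
  assumes "\<alpha> \<in> semi_arcs D"
  shows "left_normal \<alpha> \<noteq> right_normal \<alpha>"
  using left_normal_neq_right_normal semi_arc_props[OF assms] by blast

text \<open>
  Although a semi-arc stops before the crossing, \<open>\<omega>\<close> is continuous there, so the normal
  has a limit that is known explicitly. All statements about coherence at a crossing thereby become
  statements about which of the two normals each semi-arc carries.
\<close>

lemma tendsto_normal_iff:
  assumes \<alpha>: "\<alpha> \<in> semi_arcs D" and \<nu>: "\<nu> \<in> normal_orientations D \<alpha>"
    and x: "x \<in> crossing_points D" "x \<in> link_points D" "x \<in> closure \<alpha>"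
  shows "(\<nu> \<longlongrightarrow> n) (at x within \<alpha>) \<longleftrightarrow>
    n = (if \<nu> = right_normal \<alpha> then quarter_turn (\<omega> x) else - quarter_turn (\<omega> x))"
proof -
  let ?n = "if \<nu> = right_normal \<alpha> then quarter_turn (\<omega> x) else - quarter_turn (\<omega> x)"
  have "x islimpt \<alpha>"
    using x semi_arc_props(4)[OF \<alpha>] by (auto simp: closure_def)
  then have nontriv: "at x within \<alpha> \<noteq> bot" by (simp add: trivial_limit_within)
  have J: "((\<lambda>x. quarter_turn (\<omega> x)) \<longlongrightarrow> quarter_turn (\<omega> x)) (at x within \<alpha>)"
    using continuous_on_quarter_turn_orientation x(2) semi_arc_props(3)[OF \<alpha>]
    by (meson continuous_on_def tendsto_within_subset)
  have "(\<nu> \<longlongrightarrow> ?n) (at x within \<alpha>)"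
  proof (cases "\<nu> = right_normal \<alpha>")
    case True
    have "(\<nu> \<longlongrightarrow> quarter_turn (\<omega> x)) (at x within \<alpha>)"
      by (rule Lim_transform_within[OF J, of 1]) (auto simp: True right_normal_def)
    then show ?thesis using True by simp
  next
    case False
    then have "\<nu> = left_normal \<alpha>" using semi_arc_normal_cases[OF \<alpha> \<nu>] by blast
    then have "(\<nu> \<longlongrightarrow> - quarter_turn (\<omega> x)) (at x within \<alpha>)"
      by (intro Lim_transform_within[OF tendsto_minus[OF J], of 1]) (auto simp: left_normal_def)
    then show ?thesis using False by simp
  qed
  then show ?thesis using tendsto_unique[OF nontriv] by blast
qed

section \<open>Colorings of semi-arcs\<close>

text \<open>
  The coloring conditions for semi-arcs that all carry the right normal of \<open>\<omega>\<close>. They are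
  the common ground of the two notions of coloring: quandle colorings of arcs restrict to them,
  and assignments of a symmetric quandle reduce to them once labels are measured against
  \<open>\<omega>\<close>.
\<close>

definition semi_arc_coloring :: "('b \<Rightarrow> 'b \<Rightarrow> 'b) \<Rightarrow> (space set \<Rightarrow> 'b) \<Rightarrow> bool" where
  "semi_arc_coloring f N \<longleftrightarrow>
     (\<forall>(p, q)\<in>crossings D. \<forall>\<alpha>\<in>semi_arcs D. \<forall>\<beta>\<in>semi_arcs D.
        p \<in> closure \<alpha> \<and> p \<in> closure \<beta> \<longrightarrow> N \<alpha> = N \<beta>) \<and>
     (\<forall>(p, q)\<in>crossings D. \<forall>\<alpha>\<in>semi_arcs D. \<forall>\<beta>\<in>semi_arcs D. \<forall>\<sigma>\<in>semi_arcs D.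
        p \<in> closure \<sigma> \<and> points_from_to q (quarter_turn (\<omega> p)) \<alpha> \<beta> \<longrightarrow> f (N \<alpha>) (N \<sigma>) = N \<beta>)"

lemma semi_arc_coloring_cong:
  assumes "\<And>\<alpha>. \<alpha> \<in> semi_arcs D \<Longrightarrow> M \<alpha> = N \<alpha>"
  shows "semi_arc_coloring f M \<longleftrightarrow> semi_arc_coloring f N"
  unfolding semi_arc_coloring_def using assms by (simp cong: ball_cong)

lemma semi_arc_coloring_double_Pos:
  "semi_arc_coloring (double_op X f) (\<lambda>\<alpha>. (N \<alpha>, Pos)) \<longleftrightarrow> semi_arc_coloring f N"
  by (simp add: semi_arc_coloring_def double_op_def)

text \<open>
  A semi-arc accumulating at an upper crossing point \<open>p\<close> lies in the arc through
  \<open>p\<close>, so the over-condition is automatic for labels that come from arcs. For the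
  under-condition, an arc ends on a given side of the over-arc exactly if one of its semi-arcs
  does.
\<close>

lemma Col_iff_semi_arc_coloring:
  assumes c: "c \<in> arcs D \<rightarrow>\<^sub>E X"
  shows "c \<in> Col X f D \<omega> \<longleftrightarrow> semi_arc_coloring f (\<lambda>\<alpha>. c (arc_of \<alpha>))"
proof
  assume col: "c \<in> Col X f D \<omega>"
  have over: "arc_of \<alpha> = arc_of \<beta> \<and> p \<in> arc_of \<alpha>"
    if pq: "(p, q) \<in> crossings D" and \<alpha>: "\<alpha> \<in> semi_arcs D" and \<beta>: "\<beta> \<in> semi_arcs D"
    and cl: "p \<in> closure \<alpha>" "p \<in> closure \<beta>" for p q \<alpha> \<beta>
  proof -
    have p: "p \<in> link_points D - snd ` crossings D"
      using upper_not_lower[OF pq] crossing_points_in_link[OF pq] by blast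
    have "p \<in> closure (arc_of \<alpha>)"
      using cl(1) closure_mono[OF arc_of(2)[OF \<alpha>]] by blast
    then have "p \<in> arc_of \<alpha>"
      by (rule component_relatively_closed[OF arc_of(1)[OF \<alpha>, unfolded arcs_def] p])
    then show ?thesis using arc_of_eq_if_closure_meets[OF \<beta> arc_of(1)[OF \<alpha>] _ cl(2)] by simp
  qed
  have under: "f (c (arc_of \<alpha>)) (c (arc_of \<sigma>)) = c (arc_of \<beta>)"
    if pq: "(p, q) \<in> crossings D" and \<alpha>: "\<alpha> \<in> semi_arcs D" and \<beta>: "\<beta> \<in> semi_arcs D"
    and \<sigma>: "\<sigma> \<in> semi_arcs D" and cl: "p \<in> closure \<sigma>"
    and pft: "points_from_to q (quarter_turn (\<omega> p)) \<alpha> \<beta>" for p q \<alpha> \<beta> \<sigma>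
  proof -
    have p: "p \<in> arc_of \<sigma>" using over[OF pq \<sigma> \<sigma> cl cl] by simp
    note sub = arc_props(3)[OF arc_of(1)[OF \<sigma>]]
    have "closure {y \<in> \<tau>. P y} \<subseteq> closure {y \<in> arc_of \<tau>. P y}" if "\<tau> \<in> semi_arcs D" for \<tau> P
      using arc_of(2)[OF that] by (intro closure_mono) blast
    note mono = subsetD[OF this]
    have "points_from_to q (quarter_turn (\<omega> p)) (arc_of \<alpha>) (arc_of \<beta>)"
      using pft mono[OF \<alpha>] mono[OF \<beta>] unfolding points_from_to_def by simp
    then have "points_from_to q (right_normal (arc_of \<sigma>) p) (arc_of \<alpha>) (arc_of \<beta>)"
      using p by (simp add: right_normal_def)
    moreover have "right_handed_on (arc_of \<sigma>) \<omega> (right_normal (arc_of \<sigma>))"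
      using right_handed_on_iff right_left_normal_in(1) sub by blast
    ultimately show ?thesis
      by (intro CollectD[OF col[unfolded Col_def], THEN conjunct2, THEN bspec, OF pq,
            unfolded prod.case, rule_format, OF arc_of(1)[OF \<alpha>] arc_of(1)[OF \<beta>] arc_of(1)[OF \<sigma>]
            right_left_normal_in(1)[OF sub] conjI[OF p conjI]])
  qed
  show "semi_arc_coloring f (\<lambda>\<alpha>. c (arc_of \<alpha>))"
    unfolding semi_arc_coloring_def
  proof (intro conjI ballI; clarify)
    fix p q \<alpha> \<beta>
    assume "(p, q) \<in> crossings D" "\<alpha> \<in> semi_arcs D" "\<beta> \<in> semi_arcs D"
      "p \<in> closure \<alpha>" "p \<in> closure \<beta>"
    then show "c (arc_of \<alpha>) = c (arc_of \<beta>)" using over by metis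
  next
    fix p q \<alpha> \<beta> \<sigma>
    assume "(p, q) \<in> crossings D" "\<alpha> \<in> semi_arcs D" "\<beta> \<in> semi_arcs D" "\<sigma> \<in> semi_arcs D"
      "p \<in> closure \<sigma>" "points_from_to q (quarter_turn (\<omega> p)) \<alpha> \<beta>"
    then show "f (c (arc_of \<alpha>)) (c (arc_of \<sigma>)) = c (arc_of \<beta>)" by (rule under)
  qed
next
  assume col: "semi_arc_coloring f (\<lambda>\<alpha>. c (arc_of \<alpha>))"
  have "f (c a) (c d) = c b"
    if pq: "(p, q) \<in> crossings D" and a: "a \<in> arcs D" and b: "b \<in> arcs D"
    and d: "d \<in> arcs D" "p \<in> d" and \<nu>: "\<nu> \<in> normal_orientations D d" "right_handed_on d \<omega> \<nu>"
    and pft: "points_from_to q (\<nu> p) a b" for p q a b d \<nu>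
  proof -
    have "\<nu> = right_normal d"
      using right_handed_on_iff[OF \<nu>(1)] \<nu>(2) arc_props(3)[OF d(1)] by blast
    then have n: "\<nu> p = quarter_turn (\<omega> p)" using d(2) by (simp add: right_normal_def)
    have q: "q \<in> snd ` crossings D" using pq by force
    obtain \<alpha> where \<alpha>: "\<alpha> \<in> semi_arcs D" "arc_of \<alpha> = a"
      "q \<in> closure {y \<in> \<alpha>. (plane_proj y - plane_proj q) \<bullet> \<nu> p < 0}"
      by (rule semi_arc_approaching[OF a q pft[unfolded points_from_to_def, THEN conjunct1]])
    obtain \<beta> where \<beta>: "\<beta> \<in> semi_arcs D" "arc_of \<beta> = b"
      "q \<in> closure {y \<in> \<beta>. (plane_proj y - plane_proj q) \<bullet> \<nu> p > 0}"
      by (rule semi_arc_approaching[OF b q pft[unfolded points_from_to_def, THEN conjunct2]])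
    obtain \<sigma> where \<sigma>: "\<sigma> \<in> semi_arcs D" "p \<in> closure \<sigma>" "arc_of \<sigma> = d"
      by (rule arc_meets_semi_arc_closure[OF d])
    have "points_from_to q (quarter_turn (\<omega> p)) \<alpha> \<beta>"
      using \<alpha>(3) \<beta>(3) n by (simp add: points_from_to_def)
    then have "f (c (arc_of \<alpha>)) (c (arc_of \<sigma>)) = c (arc_of \<beta>)"
      using col[unfolded semi_arc_coloring_def, THEN conjunct2] pq \<alpha>(1) \<beta>(1) \<sigma>(1,2) by blast
    then show ?thesis by (simp only: \<alpha>(2) \<beta>(2) \<sigma>(3))
  qed
  then have "\<forall>(p, q)\<in>crossings D. \<forall>a\<in>arcs D. \<forall>b\<in>arcs D. \<forall>d\<in>arcs D. \<forall>\<nu>\<in>normal_orientations D d.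
       p \<in> d \<and> right_handed_on d \<omega> \<nu> \<and> points_from_to q (\<nu> p) a b \<longrightarrow> f (c a) (c d) = c b"
    by (intro ballI) clarify
  then show "c \<in> Col X f D \<omega>" unfolding Col_def using c by simp
qed

lemma arc_is_arc_of:
  assumes "a \<in> arcs D"
  obtains \<alpha> where "\<alpha> \<in> semi_arcs D" "arc_of \<alpha> = a"
  using arc_meets_semi_arc_closure[OF assms] arc_props(1)[OF assms] by blast

text \<open>
  Labels that agree at upper crossing points are constant along each arc, so they descend to
  arcs.
\<close>

lemma semi_arc_coloring_extends:
  assumes col: "semi_arc_coloring f N" and N: "\<And>\<alpha>. \<alpha> \<in> semi_arcs D \<Longrightarrow> N \<alpha> \<in> X"
  obtains c where "c \<in> arcs D \<rightarrow>\<^sub>E X" "\<And>\<alpha>. \<alpha> \<in> semi_arcs D \<Longrightarrow> c (arc_of \<alpha>) = N \<alpha>"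
proof -
  define pick where "pick a = (SOME \<alpha>. \<alpha> \<in> semi_arcs D \<and> arc_of \<alpha> = a)" for a
  have pick: "pick a \<in> semi_arcs D" "arc_of (pick a) = a" if "a \<in> arcs D" for a
    using someI_ex[of "\<lambda>\<alpha>. \<alpha> \<in> semi_arcs D \<and> arc_of \<alpha> = a"] arc_is_arc_of[OF that]
    unfolding pick_def by metis+
  have over: "N \<alpha> = N \<beta>" if "(p, q) \<in> crossings D" "\<alpha> \<in> semi_arcs D" "\<beta> \<in> semi_arcs D"
    "p \<in> closure \<alpha>" "p \<in> closure \<beta>" for p q \<alpha> \<beta>
    using col[unfolded semi_arc_coloring_def, THEN conjunct1] that by blast
  show thesis
  proof (rule that[of "\<lambda>a\<in>arcs D. N (pick a)"])
    show "(\<lambda>a\<in>arcs D. N (pick a)) \<in> arcs D \<rightarrow>\<^sub>E X" using pick(1) N by auto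
    show "(\<lambda>a\<in>arcs D. N (pick a)) (arc_of \<alpha>) = N \<alpha>" if \<alpha>: "\<alpha> \<in> semi_arcs D" for \<alpha>
      using constant_on_arcs[of N, OF over pick(1)[OF arc_of(1)[OF \<alpha>]] \<alpha>]
        pick(2)[OF arc_of(1)[OF \<alpha>]] arc_of(1)[OF \<alpha>]
      by simp
  qed
qed

end

section \<open>Labels measured against a fixed orientation\<close>

lemma points_from_to_minus: "points_from_to q (- n) \<alpha> \<beta> \<longleftrightarrow> points_from_to q n \<beta> \<alpha>"
  by (auto simp: points_from_to_def)

lemma basic_inversion_imp_assignment:
  assumes "basic_inversion X \<rho> D A B"
  shows "A \<in> assignments X D"
  using assms by (simp add: basic_inversion_def)

context symmetric_quandle
begin

lemma star_rho_eq_iff: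
  assumes "x \<in> X" "y \<in> X" "z \<in> X"
  shows "x \<triangleright> \<rho> z = y \<longleftrightarrow> y \<triangleright> z = x"
  using assms rho_right qdiv_eqI qdiv_star by metis

lemma rho_eq_iff:
  assumes "x \<in> X" "y \<in> X"
  shows "\<rho> x = \<rho> y \<longleftrightarrow> x = y" "\<rho> x = y \<longleftrightarrow> x = \<rho> y"
  using assms rho_involution by metis+

end

text \<open>
  The orientation is an auxiliary choice here: colorings by a symmetric quandle do not mention it,
  but it gives every basic-inversion class of a labelled semi-arc a preferred representative.
\<close>

locale symmetric_coloring = oriented_diagram D \<omega> + symmetric_quandle X star \<rho>
  for D \<omega> and X :: "'a set" and star (infixl "\<triangleright>" 70) and \<rho>
begin

text \<open>
  The label of the semi-arc after reversing its normal, if necessary, to the right normal of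
  \<open>\<omega>\<close>. A basic inversion changes the normal and the label but not this value, so it
  is a complete invariant of assignments up to basic inversions.
\<close>

definition label :: "'a assignment \<Rightarrow> space set \<Rightarrow> 'a" where
  "label A \<alpha> = (if fst (A \<alpha>) = right_normal \<alpha> then snd (A \<alpha>) else \<rho> (snd (A \<alpha>)))"

lemma assignment_at:
  assumes "A \<in> assignments X D" "\<alpha> \<in> semi_arcs D"
  shows "fst (A \<alpha>) \<in> normal_orientations D \<alpha>" "snd (A \<alpha>) \<in> X"
    "fst (A \<alpha>) = right_normal \<alpha> \<or> fst (A \<alpha>) = left_normal \<alpha>" "label A \<alpha> \<in> X"
proof -
  have "A \<alpha> \<in> normal_orientations D \<alpha> \<times> X" using assms by (auto simp: assignments_def)
  then show *: "fst (A \<alpha>) \<in> normal_orientations D \<alpha>" "snd (A \<alpha>) \<in> X" by (auto simp: mem_Times_iff)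
  then show "fst (A \<alpha>) = right_normal \<alpha> \<or> fst (A \<alpha>) = left_normal \<alpha>"
    using semi_arc_normal_cases[OF assms(2)] by blast
  show "label A \<alpha> \<in> X" using * rho_closed by (simp add: label_def)
qed

lemma semi_arc_normals_in:
  assumes "\<alpha> \<in> semi_arcs D"
  shows "right_normal \<alpha> \<in> normal_orientations D \<alpha>" "left_normal \<alpha> \<in> normal_orientations D \<alpha>"
  using right_left_normal_in[OF semi_arc_props(3)[OF assms]] .

lemma coherent_at_iff:
  assumes A: "A \<in> assignments X D" and \<alpha>: "\<alpha> \<in> semi_arcs D" and \<beta>: "\<beta> \<in> semi_arcs D"
    and x: "x \<in> crossing_points D" "x \<in> link_points D" "x \<in> closure \<alpha>" "x \<in> closure \<beta>"
  shows "coherent_at x A \<alpha> \<beta> \<longleftrightarrow>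
    (fst (A \<alpha>) = right_normal \<alpha> \<longleftrightarrow> fst (A \<beta>) = right_normal \<beta>)"
proof -
  have "norm (quarter_turn (\<omega> x)) = 1" using norm_orientation[OF x(2)] by simp
  moreover have "quarter_turn (\<omega> x) = 0" if "- quarter_turn (\<omega> x) = quarter_turn (\<omega> x)"
    using that by (simp add: plane_eq_iff)
  ultimately have "- quarter_turn (\<omega> x) \<noteq> quarter_turn (\<omega> x)" by (metis norm_zero zero_neq_one)
  then show ?thesis
    unfolding coherent_at_def
      tendsto_normal_iff[OF \<alpha> assignment_at(1)[OF A \<alpha>] x(1,2,3)]
      tendsto_normal_iff[OF \<beta> assignment_at(1)[OF A \<beta>] x(1,2,4)]
    by auto
qed

lemma over_condition_iff:
  assumes A: "A \<in> assignments X D"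
  shows "over_condition \<rho> D A \<longleftrightarrow>
    (\<forall>(p, q)\<in>crossings D. \<forall>\<alpha>\<in>semi_arcs D. \<forall>\<beta>\<in>semi_arcs D.
        p \<in> closure \<alpha> \<and> p \<in> closure \<beta> \<longrightarrow> label A \<alpha> = label A \<beta>)"
proof -
  have "(if coherent_at p A \<alpha> \<beta> then snd (A \<alpha>) = snd (A \<beta>) else snd (A \<alpha>) = \<rho> (snd (A \<beta>)))
      \<longleftrightarrow> label A \<alpha> = label A \<beta>"
    if pq: "(p, q) \<in> crossings D" and \<alpha>: "\<alpha> \<in> semi_arcs D" and \<beta>: "\<beta> \<in> semi_arcs D"
    and cl: "p \<in> closure \<alpha>" "p \<in> closure \<beta>" for p q \<alpha> \<beta>
    using coherent_at_iff[OF A \<alpha> \<beta> crossing_pointsI(1)[OF pq] _ cl] crossing_points_in_link[OF pq]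
      rho_eq_iff[OF assignment_at(2)[OF A \<alpha>] assignment_at(2)[OF A \<beta>]]
    by (auto simp: label_def)
  then have "(fst z \<in> closure \<alpha> \<and> fst z \<in> closure \<beta> \<longrightarrow> (if coherent_at (fst z) A \<alpha> \<beta>
        then snd (A \<alpha>) = snd (A \<beta>) else snd (A \<alpha>) = \<rho> (snd (A \<beta>)))) \<longleftrightarrow>
      (fst z \<in> closure \<alpha> \<and> fst z \<in> closure \<beta> \<longrightarrow> label A \<alpha> = label A \<beta>)"
    if "z \<in> crossings D" "\<alpha> \<in> semi_arcs D" "\<beta> \<in> semi_arcs D" for z \<alpha> \<beta>
    using that by (metis prod.collapse)
  then show ?thesis
    unfolding over_condition_def by (simp only: split_beta cong: ball_cong)
qed

text \<open>
  Reversing the under-semi-arcs is harmless because \<open>\<rho> (x \<triangleright> y) = \<rho> x \<triangleright> y\<close>.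
  Reversing the over-semi-arc exchanges the roles of \<open>\<alpha>\<close> and \<open>\<beta>\<close>, which matches
  \<open>x \<triangleright> \<rho> z = y \<longleftrightarrow> y \<triangleright> z = x\<close>.
\<close>

lemma under_condition_iff:
  assumes A: "A \<in> assignments X D"
  shows "under_condition star \<rho> D A \<longleftrightarrow>
    (\<forall>(p, q)\<in>crossings D. \<forall>\<alpha>\<in>semi_arcs D. \<forall>\<beta>\<in>semi_arcs D. \<forall>\<sigma>\<in>semi_arcs D.
        p \<in> closure \<sigma> \<and> points_from_to q (quarter_turn (\<omega> p)) \<alpha> \<beta> \<longrightarrow>
        label A \<alpha> \<triangleright> label A \<sigma> = label A \<beta>)" (is "_ \<longleftrightarrow> ?R")
proof -
  define n where "n p \<sigma> = (if fst (A \<sigma>) = right_normal \<sigma> then quarter_turn (\<omega> p)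
    else - quarter_turn (\<omega> p))" for p \<sigma>
  have lim: "(fst (A \<sigma>) \<longlongrightarrow> v) (at p within \<sigma>) \<longleftrightarrow> v = n p \<sigma>"
    if "(p, q) \<in> crossings D" "\<sigma> \<in> semi_arcs D" "p \<in> closure \<sigma>" for p q \<sigma> v
    unfolding n_def using tendsto_normal_iff assignment_at(1)[OF A] that
      crossing_pointsI(1) crossing_points_in_link by blast
  have pointwise: "(if coherent_at q A \<alpha> \<beta> then snd (A \<alpha>) \<triangleright> snd (A \<sigma>) = snd (A \<beta>)
      else snd (A \<alpha>) \<triangleright> snd (A \<sigma>) = \<rho> (snd (A \<beta>))) \<longleftrightarrow> label A \<alpha> \<triangleright> snd (A \<sigma>) = label A \<beta>"
    if pq: "(p, q) \<in> crossings D" and \<alpha>: "\<alpha> \<in> semi_arcs D" and \<beta>: "\<beta> \<in> semi_arcs D"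
    and \<sigma>: "\<sigma> \<in> semi_arcs D" and pft: "points_from_to q v \<alpha> \<beta>" for p q \<alpha> \<beta> \<sigma> v
  proof -
    have cl: "q \<in> closure \<alpha>" "q \<in> closure \<beta>"
      using pft closure_mono[of "{y \<in> _. _ y}"] unfolding points_from_to_def
      by (metis (no_types, lifting) closure_mono mem_Collect_eq subsetD subsetI)+
    note X = assignment_at(2)[OF A \<alpha>] assignment_at(2)[OF A \<beta>] assignment_at(2)[OF A \<sigma>]
    show ?thesis
      using coherent_at_iff[OF A \<alpha> \<beta> crossing_pointsI(2)[OF pq] _ cl] crossing_points_in_link[OF pq]
        rho_eq_iff[OF closed[OF X(1,3)] X(2)] rho_eq_iff(1)[OF closed[OF X(1,3)] rho_closed[OF X(2)]]
        rho_left[OF X(1,3)] rho_involution[OF X(2)]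
      by (auto simp: label_def)
  qed
  have "under_condition star \<rho> D A \<longleftrightarrow>
    (\<forall>(p, q)\<in>crossings D. \<forall>\<alpha>\<in>semi_arcs D. \<forall>\<beta>\<in>semi_arcs D. \<forall>\<sigma>\<in>semi_arcs D.
        p \<in> closure \<sigma> \<and> points_from_to q (n p \<sigma>) \<alpha> \<beta> \<longrightarrow>
        label A \<alpha> \<triangleright> snd (A \<sigma>) = label A \<beta>)" (is "_ \<longleftrightarrow> ?M")
  proof -
    have "(\<forall>v. fst z \<in> closure \<sigma> \<and> (fst (A \<sigma>) \<longlongrightarrow> v) (at (fst z) within \<sigma>) \<and>
          points_from_to (snd z) v \<alpha> \<beta> \<longrightarrow>
        (if coherent_at (snd z) A \<alpha> \<beta> then snd (A \<alpha>) \<triangleright> snd (A \<sigma>) = snd (A \<beta>)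
         else snd (A \<alpha>) \<triangleright> snd (A \<sigma>) = \<rho> (snd (A \<beta>)))) \<longleftrightarrow>
      (fst z \<in> closure \<sigma> \<and> points_from_to (snd z) (n (fst z) \<sigma>) \<alpha> \<beta> \<longrightarrow>
        label A \<alpha> \<triangleright> snd (A \<sigma>) = label A \<beta>)"
      if z: "z \<in> crossings D" and arcs: "\<alpha> \<in> semi_arcs D" "\<beta> \<in> semi_arcs D" "\<sigma> \<in> semi_arcs D"
      for z \<alpha> \<beta> \<sigma>
    proof -
      have "(fst z, snd z) \<in> crossings D" using z by simp
      from lim[OF this arcs(3)] pointwise[OF this arcs]
      show ?thesis by (cases "fst z \<in> closure \<sigma>") auto
    qed
    then show ?thesis
      unfolding under_condition_def by (simp only: split_beta cong: ball_cong)
  qed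
  also have "\<dots> \<longleftrightarrow> ?R"
  proof -
    \<comment> \<open>For a reversed over-semi-arc the condition for \<open>(\<alpha>, \<beta>)\<close> becomes the one for
      \<open>(\<beta>, \<alpha>)\<close>; quantifying over all pairs absorbs the swap.\<close>
    have step: "(points_from_to q (n p \<sigma>) \<alpha> \<beta> \<longrightarrow> label A \<alpha> \<triangleright> snd (A \<sigma>) = label A \<beta>) \<longleftrightarrow>
        (if fst (A \<sigma>) = right_normal \<sigma>
         then points_from_to q (quarter_turn (\<omega> p)) \<alpha> \<beta> \<longrightarrow> label A \<alpha> \<triangleright> label A \<sigma> = label A \<beta>
         else points_from_to q (quarter_turn (\<omega> p)) \<beta> \<alpha> \<longrightarrow> label A \<beta> \<triangleright> label A \<sigma> = label A \<alpha>)"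
      if \<alpha>: "\<alpha> \<in> semi_arcs D" and \<beta>: "\<beta> \<in> semi_arcs D" and \<sigma>: "\<sigma> \<in> semi_arcs D" for p q \<alpha> \<beta> \<sigma>
    proof (cases "fst (A \<sigma>) = right_normal \<sigma>")
      case True
      then show ?thesis by (simp add: n_def label_def)
    next
      case False
      have "label A \<alpha> \<triangleright> \<rho> (\<rho> (snd (A \<sigma>))) = label A \<beta> \<longleftrightarrow> label A \<beta> \<triangleright> \<rho> (snd (A \<sigma>)) = label A \<alpha>"
        using star_rho_eq_iff assignment_at(2,4)[OF A] rho_closed \<alpha> \<beta> \<sigma> by blast
      then have "label A \<alpha> \<triangleright> snd (A \<sigma>) = label A \<beta> \<longleftrightarrow> label A \<beta> \<triangleright> label A \<sigma> = label A \<alpha>"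
        using False rho_involution[OF assignment_at(2)[OF A \<sigma>]] by (simp add: label_def)
      then show ?thesis using False by (simp add: n_def points_from_to_minus)
    qed
    have "?M \<longleftrightarrow> (\<forall>(p, q)\<in>crossings D. \<forall>\<sigma>\<in>semi_arcs D. p \<in> closure \<sigma> \<longrightarrow>
        (\<forall>\<alpha>\<in>semi_arcs D. \<forall>\<beta>\<in>semi_arcs D.
          points_from_to q (n p \<sigma>) \<alpha> \<beta> \<longrightarrow> label A \<alpha> \<triangleright> snd (A \<sigma>) = label A \<beta>))"
      by fast
    also have "\<dots> \<longleftrightarrow> (\<forall>(p, q)\<in>crossings D. \<forall>\<sigma>\<in>semi_arcs D. p \<in> closure \<sigma> \<longrightarrow>
        (\<forall>\<alpha>\<in>semi_arcs D. \<forall>\<beta>\<in>semi_arcs D.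
          points_from_to q (quarter_turn (\<omega> p)) \<alpha> \<beta> \<longrightarrow> label A \<alpha> \<triangleright> label A \<sigma> = label A \<beta>))"
    proof -
      have "(\<forall>\<alpha>\<in>semi_arcs D. \<forall>\<beta>\<in>semi_arcs D.
            points_from_to q (n p \<sigma>) \<alpha> \<beta> \<longrightarrow> label A \<alpha> \<triangleright> snd (A \<sigma>) = label A \<beta>) \<longleftrightarrow>
          (\<forall>\<alpha>\<in>semi_arcs D. \<forall>\<beta>\<in>semi_arcs D.
            points_from_to q (quarter_turn (\<omega> p)) \<alpha> \<beta> \<longrightarrow> label A \<alpha> \<triangleright> label A \<sigma> = label A \<beta>)"
        if \<sigma>: "\<sigma> \<in> semi_arcs D" for p q \<sigma>
        using step[OF _ _ \<sigma>] by (cases "fst (A \<sigma>) = right_normal \<sigma>") (simp_all, blast)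
      then show ?thesis by (simp cong: ball_cong)
    qed
    also have "\<dots> \<longleftrightarrow> ?R" by fast
    finally show ?thesis .
  qed
  finally show ?thesis .
qed

lemma conditions_iff_semi_arc_coloring:
  assumes "A \<in> assignments X D"
  shows "over_condition \<rho> D A \<and> under_condition star \<rho> D A \<longleftrightarrow> semi_arc_coloring star (label A)"
  unfolding over_condition_iff[OF assms] under_condition_iff[OF assms] semi_arc_coloring_def ..

text \<open>
  Normal and label are reversed together, so after reversing back to the right normal the two
  applications of \<open>\<rho>\<close> cancel.
\<close>

lemma basic_inversion_step:
  assumes "basic_inversion X \<rho> D A B"
  shows "B \<in> assignments X D" "\<And>\<beta>. \<beta> \<in> semi_arcs D \<Longrightarrow> label B \<beta> = label A \<beta>"
proof -
  obtain \<alpha> where A: "A \<in> assignments X D" and \<alpha>: "\<alpha> \<in> semi_arcs D"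
    and B: "B = A(\<alpha> := ((\<lambda>x\<in>\<alpha>. - fst (A \<alpha>) x), \<rho> (snd (A \<alpha>))))"
    using assms unfolding basic_inversion_def by blast
  note at = assignment_at[OF A \<alpha>]
  have rev: "(\<lambda>x\<in>\<alpha>. - fst (A \<alpha>) x) = (if fst (A \<alpha>) = right_normal \<alpha> then left_normal \<alpha> else right_normal \<alpha>)"
    using at(3) reverse_normal by auto
  have "(\<lambda>x\<in>\<alpha>. - fst (A \<alpha>) x) \<in> normal_orientations D \<alpha>"
    unfolding rev using semi_arc_normals_in[OF \<alpha>] by simp
  then show "B \<in> assignments X D"
    using A \<alpha> rho_closed[OF at(2)] unfolding B assignments_def by (auto simp: PiE_iff extensional_def)
  show "label B \<beta> = label A \<beta>" if "\<beta> \<in> semi_arcs D" for \<beta>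
    using at(3) rho_involution[OF at(2)] semi_arc_normals_distinct[OF \<alpha>] rev
    unfolding B label_def by auto
qed

lemma equivclp_imp_label_eq:
  assumes "equivclp (basic_inversion X \<rho> D) A B" "A \<in> assignments X D"
  shows "B \<in> assignments X D \<and> (\<forall>\<beta>\<in>semi_arcs D. label B \<beta> = label A \<beta>)"
  using assms(1)
proof (induction rule: equivclp_induct)
  case base
  then show ?case using assms(2) by simp
next
  case (step B C)
  then show ?case using basic_inversion_step basic_inversion_imp_assignment by metis
qed

text \<open>
  On a semi-arc where two assignments with the same invariant differ, they have opposite normals and
  so differ by a basic inversion there. Inverting at these finitely many semi-arcs one after the other
  turns \<open>A\<close> into \<open>B\<close>.
\<close>

lemma label_eq_imp_equivclp:
  assumes A: "A \<in> assignments X D" and B: "B \<in> assignments X D"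
    and eq: "\<And>\<alpha>. \<alpha> \<in> semi_arcs D \<Longrightarrow> label A \<alpha> = label B \<alpha>"
  shows "equivclp (basic_inversion X \<rho> D) A B"
proof -
  \<comment> \<open>The assignment reached once the semi-arcs in \<open>S\<close> have been treated.\<close>
  define C where "C S \<alpha> = (if \<alpha> \<in> S then B \<alpha> else A \<alpha>)" for S \<alpha>
  have C: "C S \<in> assignments X D" if "S \<subseteq> semi_arcs D" for S
    using A B that by (auto simp: C_def assignments_def PiE_iff extensional_def)
  have "equivclp (basic_inversion X \<rho> D) A (C S)" if "finite S" "S \<subseteq> semi_arcs D" for S
    using that
  proof (induction S rule: finite_induct)
    case empty
    have "C {} = A" by (simp add: C_def fun_eq_iff)
    then show ?case by simp
  next
    case (insert \<alpha> S)
    then have \<alpha>: "\<alpha> \<in> semi_arcs D" and S: "S \<subseteq> semi_arcs D" by auto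
    have upd: "C (insert \<alpha> S) = (C S)(\<alpha> := B \<alpha>)" by (auto simp: C_def)
    have CS: "C S \<alpha> = A \<alpha>" using insert.hyps by (simp add: C_def)
    show ?case
    proof (cases "A \<alpha> = B \<alpha>")
      case True
      then have "C (insert \<alpha> S) = C S" using upd CS by (metis fun_upd_triv)
      then show ?thesis using insert.IH[OF S] by simp
    next
      case False
      note a = assignment_at[OF A \<alpha>] and b = assignment_at[OF B \<alpha>]
      have "B \<alpha> = ((\<lambda>x\<in>\<alpha>. - fst (A \<alpha>) x), \<rho> (snd (A \<alpha>)))"
        using False a(3) b(3) eq[OF \<alpha>] rho_eq_iff[OF a(2) b(2)] reverse_normal[of \<alpha>]
          semi_arc_normals_distinct[OF \<alpha>]
        by (auto simp: label_def prod_eq_iff split: if_splits)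
      then have "basic_inversion X \<rho> D (C S) (C (insert \<alpha> S))"
        unfolding basic_inversion_def using C[OF S] \<alpha> upd CS by metis
      then show ?thesis
        using insert.IH[OF S] by (meson equivclp_into_equivclp)
    qed
  qed
  from this[OF finite_semi_arcs order_refl]
  have "equivclp (basic_inversion X \<rho> D) A (C (semi_arcs D))" .
  moreover have "C (semi_arcs D) = B"
    using A B by (auto simp: C_def assignments_def fun_eq_iff PiE_def extensional_def)
  ultimately show ?thesis by simp
qed

lemma equivclp_iff_label_eq:
  assumes "A \<in> assignments X D" "B \<in> assignments X D"
  shows "equivclp (basic_inversion X \<rho> D) A B \<longleftrightarrow> (\<forall>\<alpha>\<in>semi_arcs D. label A \<alpha> = label B \<alpha>)"
  using equivclp_imp_label_eq[OF _ assms(1)] label_eq_imp_equivclp[OF assms] by metis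

definition coloring_class :: "'a assignment \<Rightarrow> 'a assignment set" where
  "coloring_class A = {B. equivclp (basic_inversion X \<rho> D) A B}"

lemma coloring_class_eq:
  assumes "A \<in> assignments X D"
  shows "coloring_class A = {B \<in> assignments X D. \<forall>\<alpha>\<in>semi_arcs D. label A \<alpha> = label B \<alpha>}"
  using equivclp_imp_label_eq[OF _ assms] equivclp_iff_label_eq[OF assms]
  unfolding coloring_class_def by blast

lemma coloring_class_eq_iff:
  assumes "A \<in> assignments X D" "B \<in> assignments X D"
  shows "coloring_class A = coloring_class B \<longleftrightarrow> (\<forall>\<alpha>\<in>semi_arcs D. label A \<alpha> = label B \<alpha>)"
proof
  assume "coloring_class A = coloring_class B"
  then have "B \<in> coloring_class A" using coloring_class_eq assms(2) by simp
  then show "\<forall>\<alpha>\<in>semi_arcs D. label A \<alpha> = label B \<alpha>" using coloring_class_eq[OF assms(1)] by blast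
qed (simp add: coloring_class_eq assms cong: conj_cong ball_cong)

lemma sym_Col_eq:
  "sym_Col X star \<rho> D =
    {coloring_class A | A. A \<in> assignments X D \<and> semi_arc_coloring star (label A)}"
  unfolding sym_Col_def quotient_def coloring_class_def
  using conditions_iff_semi_arc_coloring by (auto simp: Image_def)

definition right_assignment :: "(space set \<Rightarrow> 'a) \<Rightarrow> 'a assignment" where
  "right_assignment N = (\<lambda>\<alpha>\<in>semi_arcs D. (right_normal \<alpha>, N \<alpha>))"

lemma right_assignment:
  assumes "\<And>\<alpha>. \<alpha> \<in> semi_arcs D \<Longrightarrow> N \<alpha> \<in> X"
  shows "right_assignment N \<in> assignments X D"
    "\<And>\<alpha>. \<alpha> \<in> semi_arcs D \<Longrightarrow> label (right_assignment N) \<alpha> = N \<alpha>"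
  using assms semi_arc_normals_in(1)
  by (auto simp: right_assignment_def assignments_def label_def)

end

section \<open>Canonical forms for the symmetric double\<close>

lemma (in oriented_diagram) right_handed_orientations_agree:
  assumes "\<omega>' \<in> orientations D" and \<nu>: "\<nu> \<in> normal_orientations D \<alpha>" and \<alpha>: "\<alpha> \<subseteq> link_points D"
    and rh: "right_handed_on \<alpha> \<omega> \<nu>" "right_handed_on \<alpha> \<omega>' \<nu>" and x: "x \<in> \<alpha>"
  shows "\<omega>' x = \<omega> x"
proof -
  interpret O: oriented_diagram D \<omega>' using diagram assms(1) by unfold_locales
  have "right_normal \<alpha> = O.right_normal \<alpha>"
    using rh right_handed_on_iff[OF \<nu> \<alpha>] O.right_handed_on_iff[OF \<nu> \<alpha>] by simp
  from fun_cong[OF this, of x] show ?thesis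
    using x by (simp add: right_normal_def O.right_normal_def quarter_turn_inject)
qed

locale double_coloring = oriented_diagram D \<omega> + quandle X star
  for D \<omega> and X :: "'a set" and star (infixl "\<triangleright>" 70)

sublocale double_coloring \<subseteq> S: symmetric_coloring D \<omega> "double_carrier X" "double_op X star" double_inv
  by (intro symmetric_coloring.intro symmetric_double oriented_diagram_axioms)

context double_coloring
begin

abbreviation double_assignments :: "('a \<times> sign) assignment set" where
  "double_assignments \<equiv> assignments (double_carrier X) D"

definition positive :: "('a \<times> sign) assignment \<Rightarrow> bool" where
  "positive A \<longleftrightarrow> (\<forall>\<alpha>\<in>semi_arcs D. snd (snd (A \<alpha>)) = Pos)"

lemma Col_double_eq:
  "Col_double X star D = {S.coloring_class A | A.
     A \<in> double_assignments \<and> semi_arc_coloring (double_op X star) (S.label A)}"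
  unfolding Col_double_def by (rule S.sym_Col_eq)

lemma positive_label_sign:
  assumes "positive K" "\<alpha> \<in> semi_arcs D"
  shows "snd (S.label K \<alpha>) = Pos \<longleftrightarrow> fst (K \<alpha>) = right_normal \<alpha>"
  using assms by (simp add: positive_def S.label_def double_inv_def)

text \<open>
  The involution of the double flips signs, so positivity of a label forces the normal to be the
  right one exactly where the invariant is positive. Hence the invariant determines both normal and
  label.
\<close>

lemma positive_unique:
  assumes K: "K \<in> double_assignments" "positive K" and L: "L \<in> double_assignments" "positive L"
    and eq: "\<And>\<alpha>. \<alpha> \<in> semi_arcs D \<Longrightarrow> S.label K \<alpha> = S.label L \<alpha>"
  shows "K = L"
proof (rule extensionalityI[of _ "semi_arcs D"])
  show "K \<in> extensional (semi_arcs D)" "L \<in> extensional (semi_arcs D)"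
    using K(1) L(1) by (auto simp: assignments_def PiE_def)
  fix \<alpha> assume \<alpha>: "\<alpha> \<in> semi_arcs D"
  have iff: "fst (K \<alpha>) = right_normal \<alpha> \<longleftrightarrow> fst (L \<alpha>) = right_normal \<alpha>"
    using positive_label_sign K(2) L(2) \<alpha> eq by metis
  then have "fst (K \<alpha>) = fst (L \<alpha>)"
    using S.assignment_at(3)[OF K(1) \<alpha>] S.assignment_at(3)[OF L(1) \<alpha>] by auto
  moreover have "snd (K \<alpha>) = snd (L \<alpha>)"
    using eq[OF \<alpha>] iff K(2) L(2) \<alpha>
    by (auto simp: S.label_def positive_def double_inv_def prod_eq_iff split: if_splits)
  ultimately show "K \<alpha> = L \<alpha>" by (rule prod_eqI)
qed

lemma positive_exists:
  assumes A: "A \<in> double_assignments"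
  obtains K where "K \<in> double_assignments" "positive K"
    "\<And>\<alpha>. \<alpha> \<in> semi_arcs D \<Longrightarrow> S.label K \<alpha> = S.label A \<alpha>"
proof -
  define K where "K = (\<lambda>\<alpha>\<in>semi_arcs D.
    if snd (S.label A \<alpha>) = Pos then (right_normal \<alpha>, S.label A \<alpha>)
    else (left_normal \<alpha>, double_inv (S.label A \<alpha>)))"
  have flip: "e \<noteq> Pos \<Longrightarrow> sign_flip e = Pos" for e by (cases e) auto
  show thesis
  proof (rule that[of K])
    show "K \<in> double_assignments"
      using S.semi_arc_normals_in S.assignment_at(4)[OF A] S.rho_closed
      unfolding K_def assignments_def by auto
    show "positive K" using flip by (auto simp: positive_def K_def double_inv_def)
    show "S.label K \<alpha> = S.label A \<alpha>" if "\<alpha> \<in> semi_arcs D" for \<alpha>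
      using that semi_arc_normals_distinct[OF that] S.rho_involution[OF S.assignment_at(4)[OF A that]]
      unfolding S.label_def[of K] by (simp add: K_def)
  qed
qed

lemma canonical_form:
  assumes A: "A \<in> double_assignments"
  defines "K \<equiv> canonical_form D (S.coloring_class A)"
  shows "K \<in> double_assignments" "positive K"
    "\<And>\<alpha>. \<alpha> \<in> semi_arcs D \<Longrightarrow> S.label K \<alpha> = S.label A \<alpha>"
proof -
  obtain L where L: "L \<in> double_assignments" "positive L"
    "\<And>\<alpha>. \<alpha> \<in> semi_arcs D \<Longrightarrow> S.label L \<alpha> = S.label A \<alpha>"
    using positive_exists[OF A] by blast
  have "K = L"
    unfolding K_def canonical_form_def positive_def[symmetric]
  proof (rule the_equality)
    show "L \<in> S.coloring_class A \<and> positive L" using L by (simp add: S.coloring_class_eq[OF A])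
    show "M = L" if "M \<in> S.coloring_class A \<and> positive M" for M
      using that L by (intro positive_unique) (auto simp: S.coloring_class_eq[OF A])
  qed
  with L show "K \<in> double_assignments" "positive K"
    "\<And>\<alpha>. \<alpha> \<in> semi_arcs D \<Longrightarrow> S.label K \<alpha> = S.label A \<alpha>"
    by simp_all
qed

text \<open>
  The canonical form carries the right normal of \<open>\<omega>\<close> exactly where the invariant is
  positive.
\<close>

lemma induces_orientation_iff:
  assumes A: "A \<in> double_assignments"
  shows "induces_orientation D (S.coloring_class A) \<omega> \<longleftrightarrow>
    (\<forall>\<alpha>\<in>semi_arcs D. snd (S.label A \<alpha>) = Pos)"
proof -
  let ?K = "canonical_form D (S.coloring_class A)"
  note K = canonical_form[OF A]
  have "right_handed_on \<alpha> \<omega> (fst (?K \<alpha>)) \<longleftrightarrow> snd (S.label A \<alpha>) = Pos"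
    if \<alpha>: "\<alpha> \<in> semi_arcs D" for \<alpha>
    using right_handed_on_iff[OF S.assignment_at(1)[OF K(1) \<alpha>] semi_arc_props(3)[OF \<alpha>]]
      positive_label_sign[OF K(2) \<alpha>] K(3)[OF \<alpha>]
    by simp
  then show ?thesis unfolding induces_orientation_def using orientation by simp
qed

text \<open>
  The relation asks for some orientation induced by both colorings. Two orientations that are
  right-handed with the same normals agree on semi-arcs, which is all that inducing an orientation
  depends on, so \<open>\<omega>\<close> itself serves as the witness.
\<close>

lemma ori_rel_class:
  assumes C: "C \<in> Col_double X star D" "induces_orientation D C \<omega>"
  shows "ori_rel X star D `` {C} = {C' \<in> Col_double X star D. induces_orientation D C' \<omega>}"
proof -
  obtain A where A: "A \<in> double_assignments" "C = S.coloring_class A"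
    using C(1) unfolding Col_double_eq by blast
  have "induces_orientation D C' \<omega>"
    if \<omega>': "induces_orientation D C \<omega>'" and C': "induces_orientation D C' \<omega>'" for C' \<omega>'
  proof -
    have agree: "\<omega>' x = \<omega> x" if \<alpha>: "\<alpha> \<in> semi_arcs D" and x: "x \<in> \<alpha>" for \<alpha> x
    proof (rule right_handed_orientations_agree[OF _ _ semi_arc_props(3)[OF \<alpha>] _ _ x])
      show "\<omega>' \<in> orientations D" "right_handed_on \<alpha> \<omega>' (fst (canonical_form D C \<alpha>))"
        using \<omega>' \<alpha> by (simp_all add: induces_orientation_def)
      show "right_handed_on \<alpha> \<omega> (fst (canonical_form D C \<alpha>))"
        using C(2) \<alpha> by (simp add: induces_orientation_def)
      show "fst (canonical_form D C \<alpha>) \<in> normal_orientations D \<alpha>"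
        unfolding A(2) by (rule S.assignment_at(1)[OF canonical_form(1)[OF A(1)] \<alpha>])
    qed
    have "right_handed_on \<alpha> \<omega> (fst (canonical_form D C' \<alpha>))" if "\<alpha> \<in> semi_arcs D" for \<alpha>
      using C' that agree[OF that] unfolding induces_orientation_def right_handed_on_def by metis
    then show ?thesis using orientation by (simp add: induces_orientation_def)
  qed
  then show ?thesis using C unfolding ori_rel_def by blast
qed

section \<open>The correspondence\<close>

definition lift_assignment :: "(space set \<Rightarrow> 'a) \<Rightarrow> ('a \<times> sign) assignment" where
  "lift_assignment c = S.right_assignment (\<lambda>\<alpha>. (c (arc_of \<alpha>), Pos))"

definition double_of_coloring :: "(space set \<Rightarrow> 'a) \<Rightarrow> ('a \<times> sign) assignment set" where
  "double_of_coloring c = S.coloring_class (lift_assignment c)"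

lemma lift_assignment:
  assumes "c \<in> arcs D \<rightarrow>\<^sub>E X"
  shows "lift_assignment c \<in> double_assignments"
    "\<And>\<alpha>. \<alpha> \<in> semi_arcs D \<Longrightarrow> S.label (lift_assignment c) \<alpha> = (c (arc_of \<alpha>), Pos)"
proof -
  have "(c (arc_of \<alpha>), Pos) \<in> double_carrier X" if "\<alpha> \<in> semi_arcs D" for \<alpha>
    using assms arc_of(1)[OF that] by (auto simp: double_carrier_def)
  from S.right_assignment[of "\<lambda>\<alpha>. (c (arc_of \<alpha>), Pos)", OF this]
  show "lift_assignment c \<in> double_assignments"
    "\<And>\<alpha>. \<alpha> \<in> semi_arcs D \<Longrightarrow> S.label (lift_assignment c) \<alpha> = (c (arc_of \<alpha>), Pos)"
    unfolding lift_assignment_def by simp_all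
qed

text \<open>
  Classes correspond to their invariants. Those inducing \<open>\<omega>\<close> have invariants with
  values in the positive copy of \<open>X\<close>, on which the operation of the double is that of
  \<open>X\<close>; these invariants are semi-arc colorings by \<open>X\<close>, that is, colorings of the
  arcs.
\<close>

lemma bij_betw_double_of_coloring:
  "bij_betw double_of_coloring (Col X star D \<omega>)
     {C \<in> Col_double X star D. induces_orientation D C \<omega>}"
proof (rule bij_betw_imageI)
  have Col_sub: "Col X star D \<omega> \<subseteq> arcs D \<rightarrow>\<^sub>E X" by (auto simp: Col_def)
  show "inj_on double_of_coloring (Col X star D \<omega>)"
  proof (rule inj_onI)
    fix c d assume cd: "c \<in> Col X star D \<omega>" "d \<in> Col X star D \<omega>"
      and eq: "double_of_coloring c = double_of_coloring d"
    have c: "c \<in> arcs D \<rightarrow>\<^sub>E X" and d: "d \<in> arcs D \<rightarrow>\<^sub>E X" using cd Col_sub by auto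
    have "c (arc_of \<alpha>) = d (arc_of \<alpha>)" if "\<alpha> \<in> semi_arcs D" for \<alpha>
      using eq S.coloring_class_eq_iff[OF lift_assignment(1)[OF c] lift_assignment(1)[OF d]] that
        lift_assignment(2)[OF c that] lift_assignment(2)[OF d that]
      unfolding double_of_coloring_def by simp
    then show "c = d"
      using c d arc_is_arc_of by (intro PiE_ext[of c "arcs D" "\<lambda>_. X" d]) metis+
  qed
  show "double_of_coloring ` Col X star D \<omega>
      = {C \<in> Col_double X star D. induces_orientation D C \<omega>}"
  proof (intro equalityI subsetI)
    fix C assume "C \<in> double_of_coloring ` Col X star D \<omega>"
    then obtain c where c: "c \<in> Col X star D \<omega>" and C: "C = double_of_coloring c" by blast
    have cX: "c \<in> arcs D \<rightarrow>\<^sub>E X" using c Col_sub by blast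
    let ?A = "lift_assignment c"
    note A = lift_assignment(1)[OF cX] and lab = lift_assignment(2)[OF cX]
    have "semi_arc_coloring star (\<lambda>\<alpha>. c (arc_of \<alpha>))"
      using c Col_iff_semi_arc_coloring[OF cX] by simp
    then have "semi_arc_coloring (double_op X star) (S.label ?A)"
      using semi_arc_coloring_cong[of "S.label ?A" "\<lambda>\<alpha>. (c (arc_of \<alpha>), Pos)"] lab
      by (simp add: semi_arc_coloring_double_Pos)
    then have "C \<in> Col_double X star D"
      unfolding Col_double_eq C double_of_coloring_def using A by blast
    moreover have "induces_orientation D C \<omega>"
      unfolding C double_of_coloring_def induces_orientation_iff[OF A] using lab by simp
    ultimately show "C \<in> {C \<in> Col_double X star D. induces_orientation D C \<omega>}" by simp
  next
    fix C assume "C \<in> {C \<in> Col_double X star D. induces_orientation D C \<omega>}"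
    then obtain A where A: "A \<in> double_assignments" and C: "C = S.coloring_class A"
      and col: "semi_arc_coloring (double_op X star) (S.label A)" and ind: "induces_orientation D C \<omega>"
      unfolding Col_double_eq by blast
    define N where "N \<alpha> = fst (S.label A \<alpha>)" for \<alpha>
    have lab: "S.label A \<alpha> = (N \<alpha>, Pos)" if "\<alpha> \<in> semi_arcs D" for \<alpha>
      using ind that unfolding C induces_orientation_iff[OF A] N_def by (simp add: prod_eq_iff)
    have "semi_arc_coloring star N"
      using col semi_arc_coloring_cong[of "S.label A" "\<lambda>\<alpha>. (N \<alpha>, Pos)"] lab
      by (simp add: semi_arc_coloring_double_Pos)
    moreover have "N \<alpha> \<in> X" if "\<alpha> \<in> semi_arcs D" for \<alpha>
      using S.assignment_at(4)[OF A that] lab[OF that] by (simp add: double_carrier_def)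
    ultimately obtain c where c: "c \<in> arcs D \<rightarrow>\<^sub>E X"
      and cN: "\<And>\<alpha>. \<alpha> \<in> semi_arcs D \<Longrightarrow> c (arc_of \<alpha>) = N \<alpha>"
      using semi_arc_coloring_extends by metis
    have "c \<in> Col X star D \<omega>"
      using Col_iff_semi_arc_coloring[OF c] semi_arc_coloring_cong[OF cN] \<open>semi_arc_coloring star N\<close>
      by simp
    moreover have "double_of_coloring c = C"
      unfolding double_of_coloring_def C
      using S.coloring_class_eq_iff[OF lift_assignment(1)[OF c] A] lift_assignment(2)[OF c] cN lab by simp
    ultimately show "C \<in> double_of_coloring ` Col X star D \<omega>" by blast
  qed
qed

end

theorem theorem5p3:
  fixes X :: "'a set" and star :: "'a \<Rightarrow> 'a \<Rightarrow> 'a"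
    and D :: diagram and \<omega> :: "space \<Rightarrow> plane"
    and C :: "('a \<times> sign) assignment set"
  assumes "quandle X star"
    and "link_diagram D"
    and "\<omega> \<in> orientations D"
    and "C \<in> Col_double X star D"
    and "induces_orientation D C \<omega>"
  shows "(\<exists>F. bij_betw F (Col X star D \<omega>) (ori_rel X star D `` {C})) \<and>
         (card_of (Col X star D \<omega>), card_of (ori_rel X star D `` {C})) \<in> ordIso"
proof -
  interpret double_coloring D \<omega> X star
    using assms by (simp add: double_coloring_def oriented_diagram_def)
  have "bij_betw double_of_coloring (Col X star D \<omega>) (ori_rel X star D `` {C})"
    using bij_betw_double_of_coloring ori_rel_class[OF assms(4,5)] by simp
  then show ?thesis using card_of_ordIso by blast
qed

end
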